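(* Let $x$ be real with $|x|<1$. For every index $\mathbf{k}$ (finite, possibly empty, sequence of positive integers) we have, in $\mathbb{R}[T]$, \[P^{(x)}(\mathbf{k};T)=\rho\Bigl(Z_\ast^{(x)}\bigl(\mathbf{k};T-\gamma-\psi(1+x)\bigr)\Bigr).\]
   Context: For an index $\mathbf{k}=(k_1,\ldots,k_r)$, integer $N\ge1$ and $0<t<1$, let $\zeta_N^{(x)}(\mathbf{k})=\sum_{0<m_1<\cdots<m_r<N}\prod_{i}(m_i+x)^{-k_i}$ and $\mathrm{Li}_\mathbf{k}^{(x)}(t)=\sum_{0<m_1<\cdots<m_r}t^{m_r+x}\prod_i(m_i+x)^{-k_i}$ (both $=1$ for $\mathbf{k}=\varnothing$). $Z_\ast^{(x)}(\mathbf{k};T)\in\mathbb{R}[T]$ is the unique polynomial with $\zeta_N^{(x)}(\mathbf{k})=Z_\ast^{(x)}(\mathbf{k};\log N-\psi(1+x))+O(N^{-1}\log^pN)$ as $N\to\infty$ for some $p>0$, and $P^{(x)}(\mathbf{k};T)\in\mathbb{R}[T]$ is the unique polynomial with $\mathrm{Li}_\mathbf{k}^{(x)}(t)=P^{(x)}(\mathbf{k};-\log(1-t))+O((1-t)\log^p(1-t))$ as $t\to1^-$ for some $p>0$ (these polynomials exist). Here $\psi=\Gamma'/\Gamma$ is the digamma function and $\gamma$ is Euler's constant. The map $\rho:\mathbb{R}[T]\to\mathbb{R}[T]$ is the $\mathbb{R}$-linear map defined by the identity $\rho(e^{Ty})=A(y)e^{Ty}$ in $\mathbb{R}[T][[y]]$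 ($\rho$ acting coefficientwise in $y$), where $A(y)=e^{\gamma y}\Gamma(1+y)=\exp\bigl(\sum_{n\ge2}\frac{(-1)^n}{n}\zeta(n)y^n\bigr)$; i.e. $\rho(T^n/n!)$ is the coefficient of $y^n$ in $A(y)e^{Ty}$. *)

theory Defs
  imports "HOL-Analysis.Analysis" "HOL-Computational_Algebra.Computational_Algebra"
    "HOL-Library.Landau_Symbols"
begin

definition incr_tuples :: "nat \<Rightarrow> nat set \<Rightarrow> nat list set" where
  "incr_tuples r S = {ms. length ms = r \<and> sorted_wrt (<) ms \<and> set ms \<subseteq> S}"

definition mz_term :: "real \<Rightarrow> nat list \<Rightarrow> nat list \<Rightarrow> real" where
  "mz_term x ks ms = (\<Prod>i<length ks. 1 / (real (ms ! i) + x) ^ (ks ! i))"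

definition zeta_trunc :: "real \<Rightarrow> nat list \<Rightarrow> nat \<Rightarrow> real" where
  "zeta_trunc x ks N = (\<Sum>ms\<in>incr_tuples (length ks) {0<..<N}. mz_term x ks ms)"

definition Li :: "real \<Rightarrow> nat list \<Rightarrow> real \<Rightarrow> real" where
  "Li x ks t = (if ks = [] then 1
     else (\<Sum>\<^sub>\<infinity>ms\<in>incr_tuples (length ks) {0<..}. t powr (real (last ms) + x) * mz_term x ks ms))"

definition Zstar :: "real \<Rightarrow> nat list \<Rightarrow> real poly" where
  "Zstar x ks = (THE Q. \<exists>p::nat. p > 0 \<and>
     (\<lambda>N. zeta_trunc x ks N - poly Q (ln (real N) - Digamma (1 + x)))
        \<in> O(\<lambda>N. ln (real N) ^ p / real N))"

definition Ppoly :: "real \<Rightarrow> nat list \<Rightarrow> real poly" where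
  "Ppoly x ks = (THE Q. \<exists>p::nat. p > 0 \<and>
     (\<lambda>t. Li x ks t - poly Q (- ln (1 - t)))
        \<in> O[at_left 1](\<lambda>t. (1 - t) * ln (1 - t) ^ p))"

text \<open>The Taylor series at \<open>0\<close> of \<open>y \<mapsto> exp (\<gamma> y) \<Gamma>(1 + y)\<close>.\<close>
definition A_fps :: "real fps" where
  "A_fps = Abs_fps (\<lambda>n. (deriv ^^ n) (\<lambda>y. exp (euler_mascheroni * y) * Gamma (1 + y)) 0 / fact n)"

text \<open>The series \<open>e\<^sup>T\<^sup>y\<close> in \<open>\<real>[T][[y]]\<close>.\<close>
definition exp_Ty :: "real poly fps" where
  "exp_Ty = Abs_fps (\<lambda>n. monom (1 / fact n) n)"

definition A_exp_Ty :: "real poly fps" where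
  "A_exp_Ty = Abs_fps (\<lambda>n. [:fps_nth A_fps n:]) * exp_Ty"

text \<open>The linear extension of \<open>T\<^sup>n / n! \<mapsto> [y\<^sup>n] (A(y) e\<^sup>T\<^sup>y)\<close>; the lemmas below confirm
  linearity and the identity \<open>\<rho>(e\<^sup>T\<^sup>y) = A(y) e\<^sup>T\<^sup>y\<close>, which together determine \<open>\<rho>\<close>.\<close>
definition rho :: "real poly \<Rightarrow> real poly" where
  "rho f = (\<Sum>n\<le>degree f. smult (coeff f n * fact n) (fps_nth A_exp_Ty n))"

lemma rho_altdef:
  assumes "degree f \<le> d"
  shows "rho f = (\<Sum>n\<le>d. smult (coeff f n * fact n) (fps_nth A_exp_Ty n))"
  unfolding rho_def using assms
  by (intro sum.mono_neutral_left) (auto simp: coeff_eq_0)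

lemma rho_add: "rho (f + g) = rho f + rho g"
proof -
  let ?d = "max (degree f) (degree g)"
  have "degree (f + g) \<le> ?d"
    by (rule degree_add_le_max)
  then show ?thesis
    by (simp add: rho_altdef[of _ ?d] smult_add_left ring_distribs flip: sum.distrib)
qed

lemma smult_sum_right: "smult c (\<Sum>i\<in>I. g i) = (\<Sum>i\<in>I. smult c (g i))"
  by (induction I rule: infinite_finite_induct) (auto simp: smult_add_right)

lemma rho_smult: "rho (smult c f) = smult c (rho f)"
  by (simp add: rho_altdef[OF degree_smult_le] smult_sum_right mult_ac)
    (simp add: rho_def smult_sum_right mult_ac)

lemma rho_exp_Ty: "Abs_fps (\<lambda>n. rho (fps_nth exp_Ty n)) = A_exp_Ty"
proof (rule fps_ext)
  fix n
  have "rho (monom (1 / fact n) n) =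
      (\<Sum>k\<le>n. if k = n then fps_nth A_exp_Ty n else 0)"
    unfolding rho_altdef[OF degree_monom_le] by (rule sum.cong) auto
  then show "fps_nth (Abs_fps (\<lambda>n. rho (fps_nth exp_Ty n))) n = fps_nth A_exp_Ty n"
    by (simp add: exp_Ty_def)
qed

end

theory Submission
  imports Defs "HOL-Real_Asymp.Real_Asymp"
begin

text \<open>Summation by parts gives \<open>Li(t) = t\<^bsup>x - 1\<^esup> (1 - t) \<Sum>\<^sub>N \<zeta>\<^sub>N t\<^sup>N\<close>, so only the Abel means of
  \<open>(log N + \<gamma>)\<^sup>n\<close> are needed. Let \<open>e\<^sub>N\<^sub>,\<^sub>n\<close> be the coefficient of \<open>y\<^sup>n\<close> in
  \<open>\<Prod>\<^sub>j\<^sub>\<le>\<^sub>N (1 + y / j)\<close>. The Abel mean of \<open>N \<mapsto> e\<^sub>N\<^sub>,\<^sub>n\<close> is exactly \<open>T\<^sup>n / n!\<close> with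
  \<open>T = - log (1 - t)\<close>, and \<open>A(y) \<Prod>\<^sub>j\<^sub>\<le>\<^sub>N (1 + y / j) = exp ((log N + \<gamma>) y)\<close> up to an error of
  order \<open>log\<^sup>p N / N\<close> in every coefficient. Hence taking Abel means turns \<open>exp ((log N + \<gamma>) y)\<close>
  into \<open>A(y) exp (T y)\<close>, which is the definition of \<open>\<rho>\<close>. The expansion of \<open>\<zeta>\<^sub>N\<close> itself comes by
  induction on the index from summing \<open>log\<^sup>j N / N\<close>.\<close>

section \<open>Polylogarithmic bounds\<close>

text \<open>The base \<open>1 + ln (real N)\<close> is at least 1 for all N >= 1, so bounds can
  start at N = 1 and exponents can be raised freely when two bounds are combined.\<close>

definition polylog_bounded :: "(nat \<Rightarrow> real) \<Rightarrow> bool" where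
  "polylog_bounded f \<longleftrightarrow> (\<exists>C p. \<forall>N\<ge>1. \<bar>f N\<bar> \<le> C * (1 + ln (real N)) ^ p)"

lemma polylog_boundedI:
  assumes "\<And>N. N \<ge> 1 \<Longrightarrow> \<bar>f N\<bar> \<le> C * (1 + ln (real N)) ^ p"
  shows "polylog_bounded f"
  using assms unfolding polylog_bounded_def by blast

lemma polylog_boundedE:
  assumes "polylog_bounded f"
  obtains C p where "C \<ge> 0" "\<And>N. N \<ge> 1 \<Longrightarrow> \<bar>f N\<bar> \<le> C * (1 + ln (real N)) ^ p"
proof -
  obtain C p where Cp: "\<And>N. N \<ge> 1 \<Longrightarrow> \<bar>f N\<bar> \<le> C * (1 + ln (real N)) ^ p"
    using assms unfolding polylog_bounded_def by blast
  have "0 \<le> \<bar>f 1\<bar>" by simp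
  also have "\<dots> \<le> C" using Cp[of 1] by simp
  finally show ?thesis using that Cp by blast
qed

lemma polylog_bounded_const_bound:
  assumes "\<And>N. N \<ge> 1 \<Longrightarrow> \<bar>f N\<bar> \<le> C"
  shows "polylog_bounded f"
  by (rule polylog_boundedI[of f C 0]) (use assms in simp)

lemma polylog_bounded_const [simp]: "polylog_bounded (\<lambda>_. c)"
  by (rule polylog_bounded_const_bound[of _ "\<bar>c\<bar>"]) simp

lemma polylog_bounded_ln [simp]: "polylog_bounded (\<lambda>N. ln (real N))"
  by (rule polylog_boundedI[of _ 1 1]) simp

lemma polylog_bounded_mono:
  assumes "polylog_bounded g" "\<And>N. N \<ge> 1 \<Longrightarrow> \<bar>f N\<bar> \<le> \<bar>g N\<bar>"
  shows "polylog_bounded f"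
  using assms unfolding polylog_bounded_def by (meson order_trans)

lemma polylog_bounded_cong:
  assumes "polylog_bounded g" "\<And>N. N \<ge> 1 \<Longrightarrow> f N = g N"
  shows "polylog_bounded f"
  by (rule polylog_bounded_mono[OF assms(1)]) (simp add: assms(2))

lemma polylog_bounded_add:
  assumes "polylog_bounded f" "polylog_bounded g"
  shows "polylog_bounded (\<lambda>N. f N + g N)"
proof -
  obtain C p where f: "C \<ge> 0" "\<And>N. N \<ge> 1 \<Longrightarrow> \<bar>f N\<bar> \<le> C * (1 + ln (real N)) ^ p"
    using polylog_boundedE[OF assms(1)] by blast
  obtain D q where g: "D \<ge> 0" "\<And>N. N \<ge> 1 \<Longrightarrow> \<bar>g N\<bar> \<le> D * (1 + ln (real N)) ^ q"
    using polylog_boundedE[OF assms(2)] by blast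
  show ?thesis
  proof (rule polylog_boundedI[of _ "C + D" "p + q"])
    fix N :: nat assume N: "N \<ge> 1"
    have "C * (1 + ln (real N)) ^ p \<le> C * (1 + ln (real N)) ^ (p + q)"
      "D * (1 + ln (real N)) ^ q \<le> D * (1 + ln (real N)) ^ (p + q)"
      using N f(1) g(1) by (auto intro!: mult_left_mono power_increasing)
    with f(2)[OF N] g(2)[OF N]
    show "\<bar>f N + g N\<bar> \<le> (C + D) * (1 + ln (real N)) ^ (p + q)"
      by (simp add: algebra_simps)
  qed
qed

lemma polylog_bounded_mult:
  assumes "polylog_bounded f" "polylog_bounded g"
  shows "polylog_bounded (\<lambda>N. f N * g N)"
proof -
  obtain C p where f: "C \<ge> 0" "\<And>N. N \<ge> 1 \<Longrightarrow> \<bar>f N\<bar> \<le> C * (1 + ln (real N)) ^ p"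
    using polylog_boundedE[OF assms(1)] by blast
  obtain D q where g: "D \<ge> 0" "\<And>N. N \<ge> 1 \<Longrightarrow> \<bar>g N\<bar> \<le> D * (1 + ln (real N)) ^ q"
    using polylog_boundedE[OF assms(2)] by blast
  show ?thesis
  proof (rule polylog_boundedI[of _ "C * D" "p + q"])
    fix N :: nat assume N: "N \<ge> 1"
    have "\<bar>f N\<bar> * \<bar>g N\<bar> \<le> (C * (1 + ln (real N)) ^ p) * (D * (1 + ln (real N)) ^ q)"
      using N f g by (intro mult_mono) auto
    then show "\<bar>f N * g N\<bar> \<le> (C * D) * (1 + ln (real N)) ^ (p + q)"
      by (simp add: abs_mult power_add mult_ac)
  qed
qed

lemma polylog_bounded_cmult: "polylog_bounded f \<Longrightarrow> polylog_bounded (\<lambda>N. c * f N)"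
  using polylog_bounded_mult[of "\<lambda>_. c" f] by simp

lemma polylog_bounded_diff:
  assumes "polylog_bounded f" "polylog_bounded g"
  shows "polylog_bounded (\<lambda>N. f N - g N)"
  using polylog_bounded_add[OF assms(1) polylog_bounded_cmult[OF assms(2), of "-1"]] by simp

lemma polylog_bounded_sum:
  assumes "\<And>i. i \<in> I \<Longrightarrow> polylog_bounded (f i)"
  shows "polylog_bounded (\<lambda>N. \<Sum>i\<in>I. f i N)"
  using assms by (induction I rule: infinite_finite_induct) (auto intro: polylog_bounded_add)

lemma polylog_bounded_power: "polylog_bounded f \<Longrightarrow> polylog_bounded (\<lambda>N. f N ^ k)"
  by (induction k) (auto intro: polylog_bounded_mult)

lemma polylog_bounded_poly:
  assumes "polylog_bounded f"
  shows "polylog_bounded (\<lambda>N. poly Q (f N))"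
proof (induction Q)
  case (pCons a Q)
  then show ?case
    using polylog_bounded_add[OF polylog_bounded_const polylog_bounded_mult[OF assms pCons.IH]] by simp
qed simp

definition polylog_small :: "(nat \<Rightarrow> real) \<Rightarrow> bool" where
  "polylog_small f \<longleftrightarrow> polylog_bounded (\<lambda>N. real N * f N)"

lemma polylog_small_imp_bounded:
  assumes "polylog_small f" shows "polylog_bounded f"
proof (rule polylog_bounded_mono)
  show "polylog_bounded (\<lambda>N. real N * f N)" using assms by (simp add: polylog_small_def)
  fix N :: nat assume "N \<ge> 1"
  then have "1 * \<bar>f N\<bar> \<le> real N * \<bar>f N\<bar>" by (intro mult_right_mono) auto
  then show "\<bar>f N\<bar> \<le> \<bar>real N * f N\<bar>" by (simp add: abs_mult)
qed

lemma polylog_small_cong: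
  assumes "polylog_small g" "\<And>N. N \<ge> 1 \<Longrightarrow> f N = g N"
  shows "polylog_small f"
  using assms unfolding polylog_small_def by (auto intro: polylog_bounded_cong)

lemma polylog_small_0 [simp]: "polylog_small (\<lambda>_. 0)"
  by (simp add: polylog_small_def)

lemma polylog_small_add:
  "polylog_small f \<Longrightarrow> polylog_small g \<Longrightarrow> polylog_small (\<lambda>N. f N + g N)"
  unfolding polylog_small_def by (drule (1) polylog_bounded_add) (simp add: algebra_simps)

lemma polylog_small_diff:
  "polylog_small f \<Longrightarrow> polylog_small g \<Longrightarrow> polylog_small (\<lambda>N. f N - g N)"
  unfolding polylog_small_def by (drule (1) polylog_bounded_diff) (simp add: algebra_simps)

lemma polylog_small_mult:
  "polylog_bounded f \<Longrightarrow> polylog_small g \<Longrightarrow> polylog_small (\<lambda>N. f N * g N)"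
  unfolding polylog_small_def by (drule (1) polylog_bounded_mult) (simp add: mult_ac)

lemma polylog_small_cmult: "polylog_small f \<Longrightarrow> polylog_small (\<lambda>N. c * f N)"
  by (rule polylog_small_mult) auto

lemma polylog_small_sum:
  assumes "\<And>i. i \<in> I \<Longrightarrow> polylog_small (f i)"
  shows "polylog_small (\<lambda>N. \<Sum>i\<in>I. f i N)"
  using assms by (induction I rule: infinite_finite_induct) (auto intro: polylog_small_add)

text \<open>The shift \<open>2 * p + 1\<close> makes \<open>- d/du ((2 p + 1 + ln u)\<^sup>p / u)\<close> at least half of
  \<open>(2 p + 1 + ln u)\<^sup>p / u\<^sup>2\<close>, so that this function telescopes tails of \<open>\<Sum> log\<^sup>p n / n\<^sup>2\<close>.\<close>

lemma polylog_telescope: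
  fixes N p :: nat
  assumes N: "N \<ge> 1"
  shows "(1 + ln (real N)) ^ p / real N ^ 2 \<le>
    8 * ((real (2 * p + 1) + ln (real N)) ^ p / real N
       - (real (2 * p + 1) + ln (real (Suc N))) ^ p / real (Suc N))"
proof -
  define G where "G = (\<lambda>u::real. (real (2 * p + 1) + ln u) ^ p / u)"
  define c where "c = real (2 * p + 1)"
  define G' where "G' = (\<lambda>u::real. (real p * (c + ln u) ^ (p - 1) - (c + ln u) ^ p) / u ^ 2)"
  have "\<exists>z. real N < z \<and> z < real (Suc N) \<and>
          G (real (Suc N)) - G (real N) = (real (Suc N) - real N) * G' z"
  proof (rule MVT2)
    show "real N < real (Suc N)" by simp
    fix u assume "real N \<le> u" "u \<le> real (Suc N)"
    then have u: "u > 0" using N by linarith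
    show "(G has_real_derivative G' u) (at u)"
      unfolding G_def G'_def c_def using u
      by (auto intro!: derivative_eq_intros simp: field_simps power2_eq_square)
  qed
  then obtain z where z: "real N < z" "z < real N + 1" "G (real (Suc N)) - G (real N) = G' z"
    by auto
  have z0: "z > 0" "ln z \<ge> 0" using z N by auto
  have a: "real p * (c + ln z) ^ (p - 1) \<le> (c + ln z) ^ p / 2"
  proof (cases p)
    case (Suc q)
    have "2 * real p \<le> c + ln z" using z0 by (simp add: c_def)
    then have "2 * real p * (c + ln z) ^ q \<le> (c + ln z) * (c + ln z) ^ q"
      using z0 by (intro mult_right_mono) (auto simp: c_def)
    then show ?thesis using Suc by (simp add: algebra_simps)
  qed simp
  have "(1 + ln (real N)) ^ p \<le> (c + ln z) ^ p"
    proof (rule power_mono)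
    have "ln (real N) \<le> ln z" using N z by simp
    then show "1 + ln (real N) \<le> c + ln z" by (simp add: c_def)
  qed (use N in simp)
  \<comment> \<open>The constant 8 arises here: z < N + 1 <= 2 N costs a factor 4, and the half lost
    in \<open>a\<close> costs a factor 2.\<close>
  moreover have "z \<le> 2 * real N" using z N by linarith
  then have "z ^ 2 \<le> (2 * real N) ^ 2" using z0 by (intro power_mono) auto
  then have "z ^ 2 \<le> 4 * real N ^ 2" by (simp add: power_mult_distrib)
  ultimately have "(1 + ln (real N)) ^ p / (4 * real N ^ 2) \<le> (c + ln z) ^ p / z ^ 2"
    using N z0 by (intro frac_le) (auto simp: c_def)
  also have "\<dots> \<le> 2 * - G' z"
    using a z0 by (simp add: G'_def field_simps)
  finally show ?thesis using z(3) by (simp add: G_def)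
qed

text \<open>By \<open>polylog_telescope\<close> each increment of f is at most a decrement of a null
  sequence G. Hence f is Cauchy, and G N also bounds its distance to the limit.\<close>

lemma polylog_tail:
  assumes "polylog_bounded (\<lambda>N. real N ^ 2 * (f (Suc N) - f N))"
  shows "\<exists>c. f \<longlonglongrightarrow> c \<and> polylog_small (\<lambda>N. f N - c)"
proof -
  obtain C p where C: "C \<ge> 0"
      "\<And>N. N \<ge> 1 \<Longrightarrow> \<bar>real N ^ 2 * (f (Suc N) - f N)\<bar> \<le> C * (1 + ln (real N)) ^ p"
    using polylog_boundedE[OF assms] by blast
  define G where "G = (\<lambda>N::nat. 8 * C * ((real (2 * p + 1) + ln (real N)) ^ p / real N))"
  have f_step: "\<bar>f (Suc N) - f N\<bar> \<le> G N - G (Suc N)" if N: "N \<ge> 1" for N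
  proof -
    have "\<bar>f (Suc N) - f N\<bar> \<le> C * ((1 + ln (real N)) ^ p / real N ^ 2)"
      using C(2)[OF N] N by (simp add: abs_mult pos_le_divide_eq mult.commute)
    also have "\<dots> \<le> G N - G (Suc N)"
      using mult_left_mono[OF polylog_telescope[OF N, of p] C(1)]
      by (simp add: G_def algebra_simps)
    finally show ?thesis .
  qed
  have G0: "G N \<ge> 0" if "N \<ge> 1" for N using that C(1) by (simp add: G_def)
  have tel: "\<bar>f M - f N\<bar> \<le> G N - G M" if "N \<ge> 1" "M \<ge> N" for M N
    using that(2)
  proof (induction M rule: dec_induct)
    case (step M)
    with step(1) \<open>N \<ge> 1\<close> f_step[of M] show ?case by linarith
  qed simp
  have G_lim: "G \<longlonglongrightarrow> 0"
  proof -
    have "((\<lambda>u::real. (real (2 * p + 1) + ln u) ^ p / u) \<longlongrightarrow> 0) at_top"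
      by real_asymp
    from filterlim_compose[OF this filterlim_real_sequentially]
    show ?thesis unfolding G_def by (intro tendsto_mult_right_zero)
  qed
  have "Cauchy f"
  proof (rule metric_CauchyI)
    fix e :: real assume e: "e > 0"
    have "\<forall>\<^sub>F N in sequentially. G N < e / 2"
      using order_tendstoD(2)[OF G_lim, of "e / 2"] e by simp
    then obtain K where K: "\<And>N. N \<ge> K \<Longrightarrow> G N < e / 2"
      by (auto simp: eventually_sequentially)
    show "\<exists>M. \<forall>m\<ge>M. \<forall>n\<ge>M. dist (f m) (f n) < e"
    proof (intro exI[of _ "max 1 K"] allI impI)
      fix m n assume "m \<ge> max 1 K" "n \<ge> max 1 K"
      then show "dist (f m) (f n) < e"
        using tel[of "max 1 K" m] tel[of "max 1 K" n] K[of "max 1 K"] G0[of m] G0[of n]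
        by (simp add: dist_real_def)
    qed
  qed
  then obtain c where c: "f \<longlonglongrightarrow> c" using Cauchy_convergent_iff convergent_def by blast
  have lim: "\<bar>f N - c\<bar> \<le> G N" if N: "N \<ge> 1" for N
  proof -
    have "(\<lambda>M. \<bar>f M - f N\<bar>) \<longlonglongrightarrow> \<bar>c - f N\<bar>" by (intro tendsto_intros c)
    moreover have "\<forall>\<^sub>F M in sequentially. \<bar>f M - f N\<bar> \<le> G N"
      using eventually_ge_at_top[of N]
    proof eventually_elim
      case (elim M)
      then show ?case using tel[OF N elim] G0[of M] N by linarith
    qed
    ultimately have "\<bar>c - f N\<bar> \<le> G N" by (rule tendsto_upperbound) simp
    then show ?thesis by linarith
  qed
  have "polylog_bounded (\<lambda>N. 8 * C * (real (2 * p + 1) + ln (real N)) ^ p)"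
    by (intro polylog_bounded_cmult polylog_bounded_power polylog_bounded_add) auto
  then have "polylog_small (\<lambda>N. f N - c)"
    unfolding polylog_small_def
  proof (rule polylog_bounded_mono)
    fix N :: nat assume N: "N \<ge> 1"
    have "real N * \<bar>f N - c\<bar> \<le> real N * G N" using lim[OF N] by (intro mult_left_mono) auto
    also have "\<dots> = 8 * C * (real (2 * p + 1) + ln (real N)) ^ p" using N by (simp add: G_def)
    also have "\<dots> \<le> \<bar>8 * C * (real (2 * p + 1) + ln (real N)) ^ p\<bar>" by (rule abs_ge_self)
    finally show "\<bar>real N * (f N - c)\<bar> \<le> \<bar>8 * C * (real (2 * p + 1) + ln (real N)) ^ p\<bar>"
      by (simp only: abs_mult abs_of_nat)
  qed
  with c show ?thesis by blast
qed

lemma polylog_tail_limit: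
  assumes "polylog_bounded (\<lambda>N. real N ^ 2 * (f (Suc N) - f N))" "f \<longlonglongrightarrow> c"
  shows "polylog_small (\<lambda>N. f N - c)"
  using polylog_tail[OF assms(1)] LIMSEQ_unique[OF assms(2)] by blast

section \<open>First-order differences of polynomials in log N\<close>

lemma ln_Suc_diff:
  assumes "N \<ge> 1"
  shows "\<bar>ln (real (Suc N)) - ln (real N)\<bar> \<le> 1 / real N"
    and "\<bar>ln (real (Suc N)) - ln (real N) - 1 / real N\<bar> \<le> 1 / real N ^ 2"
proof -
  have eq: "ln (real (Suc N)) - ln (real N) = ln (1 + 1 / real N)"
    using assms ln_div[of "real (Suc N)" "real N"] by (simp add: field_simps)
  show "\<bar>ln (real (Suc N)) - ln (real N)\<bar> \<le> 1 / real N"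
    unfolding eq using ln_add_one_self_le_self[of "1 / real N"] assms by simp
  show "\<bar>ln (real (Suc N)) - ln (real N) - 1 / real N\<bar> \<le> 1 / real N ^ 2"
    unfolding eq using abs_ln_one_plus_x_minus_x_bound_nonneg[of "1 / real N"] assms
    by (simp add: power_divide)
qed

text \<open>Makes R(log N) a discrete antiderivative of R'(log n) / n, with an error whose sum
  \<open>polylog_tail\<close> controls.\<close>

lemma polylog_bounded_poly_ln_diff:
  "polylog_bounded (\<lambda>N. real N ^ 2 * (poly R (ln (real (Suc N))) - poly R (ln (real N))
     - poly (pderiv R) (ln (real N)) / real N))"
proof (induction R)
  case 0
  then show ?case by simp
next
  case (pCons a R)
  have d1: "polylog_bounded (\<lambda>N. real N * (ln (real (Suc N)) - ln (real N)))"
  proof (rule polylog_bounded_const_bound[of _ 1])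
    fix N :: nat assume "N \<ge> 1"
    then show "\<bar>real N * (ln (real (Suc N)) - ln (real N))\<bar> \<le> 1"
      using ln_Suc_diff(1)[of N] by (simp add: abs_mult field_simps)
  qed
  have d2: "polylog_bounded (\<lambda>N. real N ^ 2 * (ln (real (Suc N)) - ln (real N) - 1 / real N))"
  proof (rule polylog_bounded_const_bound[of _ 1])
    fix N :: nat assume "N \<ge> 1"
    then show "\<bar>real N ^ 2 * (ln (real (Suc N)) - ln (real N) - 1 / real N)\<bar> \<le> 1"
      using mult_left_mono[OF ln_Suc_diff(2)[of N], of "real N ^ 2"] by (simp add: abs_mult)
  qed
  have d3: "polylog_bounded (\<lambda>N. ln (real (Suc N)))"
  proof (rule polylog_boundedI[of _ 1 1])
    fix N :: nat assume N: "N \<ge> 1"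
    then have "1 / real N \<le> 1" by simp
    with ln_Suc_diff(1)[OF N] have "ln (real (Suc N)) \<le> 1 + ln (real N)" by linarith
    then show "\<bar>ln (real (Suc N))\<bar> \<le> 1 * (1 + ln (real N)) ^ 1" by simp
  qed
  show ?case
  proof (rule polylog_bounded_cong)
    \<comment> \<open>Discrete product rule for u R(u): the summands are the error for R, the error
      for the factor u, and the cost of multiplying R' by log (N + 1) instead of log N.\<close>
    show "polylog_bounded (\<lambda>N. ln (real (Suc N)) * (real N ^ 2 * (poly R (ln (real (Suc N)))
        - poly R (ln (real N)) - poly (pderiv R) (ln (real N)) / real N))
      + (real N ^ 2 * (ln (real (Suc N)) - ln (real N) - 1 / real N)) * poly R (ln (real N))
      + (real N * (ln (real (Suc N)) - ln (real N))) * poly (pderiv R) (ln (real N)))"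
      by (intro polylog_bounded_add polylog_bounded_mult d1 d2 d3 pCons.IH
            polylog_bounded_poly polylog_bounded_ln)
    fix N :: nat assume "N \<ge> 1"
    then have "real N > 0" by simp
    then show "real N ^ 2 * (poly (pCons a R) (ln (real (Suc N))) - poly (pCons a R) (ln (real N))
          - poly (pderiv (pCons a R)) (ln (real N)) / real N) =
      ln (real (Suc N)) * (real N ^ 2 * (poly R (ln (real (Suc N)))
        - poly R (ln (real N)) - poly (pderiv R) (ln (real N)) / real N))
      + (real N ^ 2 * (ln (real (Suc N)) - ln (real N) - 1 / real N)) * poly R (ln (real N))
      + (real N * (ln (real (Suc N)) - ln (real N))) * poly (pderiv R) (ln (real N))"
      by (simp add: pderiv_pCons field_simps power2_eq_square del: of_nat_Suc)
  qed
qed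

lemma pderiv_surj: "\<exists>R. pderiv R = (Q :: 'a :: field_char_0 poly)"
proof (intro exI poly_eqI)
  fix n
  let ?R = "\<Sum>i\<le>degree Q. monom (coeff Q i / of_nat (Suc i)) (Suc i)"
  have "coeff (pderiv ?R) n = of_nat (Suc n) *
      (\<Sum>i\<le>degree Q. if i = n then coeff Q n / of_nat (Suc n) else 0)"
    unfolding coeff_pderiv coeff_sum by (intro arg_cong2[of _ _ _ _ "(*)"] sum.cong) auto
  also have "\<dots> = coeff Q n"
    by (auto simp: coeff_eq_0 simp del: of_nat_Suc)
  finally show "coeff (pderiv ?R) n = coeff Q n" .
qed

section \<open>Expansion of the truncated sums\<close>

lemma finite_incr_tuples: "finite S \<Longrightarrow> finite (incr_tuples r S)"
  unfolding incr_tuples_def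
  by (rule finite_subset[OF _ finite_lists_length_eq[of S r]]) auto

text \<open>Splitting off the largest entry turns multiple sums into iterated ones. S is arbitrary
  so that the finite sums and the infinite sum of \<open>Li\<close> are both covered.\<close>

lemma bij_betw_incr_tuples_snoc:
  "bij_betw (\<lambda>(n, ms). ms @ [n]) (SIGMA n:S. incr_tuples r (S \<inter> {..<n})) (incr_tuples (Suc r) S)"
proof (rule bij_betwI[where g = "\<lambda>ms. (last ms, butlast ms)"])
  show "(\<lambda>(n, ms). ms @ [n]) \<in> (SIGMA n:S. incr_tuples r (S \<inter> {..<n})) \<rightarrow> incr_tuples (Suc r) S"
    by (auto simp: incr_tuples_def sorted_wrt_append)
  show "(\<lambda>ms. (last ms, butlast ms)) \<in> incr_tuples (Suc r) S \<rightarrow> (SIGMA n:S. incr_tuples r (S \<inter> {..<n}))"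
  proof
    fix ms assume ms: "ms \<in> incr_tuples (Suc r) S"
    then obtain ms' n where "ms = ms' @ [n]"
      by (auto simp: incr_tuples_def length_Suc_conv_rev)
    with ms show "(last ms, butlast ms) \<in> (SIGMA n:S. incr_tuples r (S \<inter> {..<n}))"
      by (auto simp: incr_tuples_def sorted_wrt_append)
  qed
qed (auto simp: incr_tuples_def intro!: append_butlast_last_id)

lemma mz_term_snoc:
  assumes "length ms = length ks"
  shows "mz_term x (ks @ [k]) (ms @ [n]) = mz_term x ks ms / (real n + x) ^ k"
  using assms by (simp add: mz_term_def nth_append)

lemma mz_term_nonneg:
  assumes "\<bar>x\<bar> < 1" "ms \<in> incr_tuples (length ks) {0<..}"
  shows "mz_term x ks ms \<ge> 0"
  unfolding mz_term_def
proof (intro prod_nonneg ballI divide_nonneg_nonneg zero_le_power)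
  fix i assume "i \<in> {..<length ks}"
  with assms have "ms ! i \<in> {0<..}"
    by (metis (mono_tags, lifting) incr_tuples_def lessThan_iff mem_Collect_eq nth_mem subsetD)
  then have "ms ! i \<ge> 1" by simp
  then have "real (ms ! i) \<ge> 1" by simp
  then show "real (ms ! i) + x \<ge> 0" using assms by linarith
qed simp

lemma zeta_trunc_Nil [simp]: "zeta_trunc x [] N = 1"
proof -
  have "incr_tuples 0 {0<..<N} = {[]}" by (auto simp: incr_tuples_def)
  then show ?thesis by (simp add: zeta_trunc_def mz_term_def)
qed

lemma zeta_trunc_nonneg: "\<bar>x\<bar> < 1 \<Longrightarrow> zeta_trunc x ks N \<ge> 0"
  unfolding zeta_trunc_def by (intro sum_nonneg mz_term_nonneg) (auto simp: incr_tuples_def)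

lemma zeta_trunc_snoc:
  "zeta_trunc x (ks @ [k]) N = (\<Sum>n\<in>{0<..<N}. zeta_trunc x ks n / (real n + x) ^ k)"
proof -
  let ?r = "length ks" and ?S = "{0<..<N}"
  have "zeta_trunc x (ks @ [k]) N =
      (\<Sum>p\<in>(SIGMA n:?S. incr_tuples ?r (?S \<inter> {..<n})).
        mz_term x (ks @ [k]) ((\<lambda>(n, ms). ms @ [n]) p))"
    unfolding zeta_trunc_def
    using sum.reindex_bij_betw[OF bij_betw_incr_tuples_snoc[of ?S ?r],
        of "mz_term x (ks @ [k])"] by simp
  also have "\<dots> = (\<Sum>n\<in>?S. \<Sum>ms\<in>incr_tuples ?r (?S \<inter> {..<n}). mz_term x (ks @ [k]) (ms @ [n]))"
    by (subst sum.Sigma) (auto intro: finite_incr_tuples simp: case_prod_unfold)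
  also have "\<dots> = (\<Sum>n\<in>?S. zeta_trunc x ks n / (real n + x) ^ k)"
  proof (rule sum.cong)
    fix n assume "n \<in> ?S"
    then have "?S \<inter> {..<n} = {0<..<n}" by auto
    then show "(\<Sum>ms\<in>incr_tuples ?r (?S \<inter> {..<n}). mz_term x (ks @ [k]) (ms @ [n])) =
        zeta_trunc x ks n / (real n + x) ^ k"
      unfolding zeta_trunc_def sum_divide_distrib
      by (intro sum.cong) (auto simp: incr_tuples_def mz_term_snoc)
  qed simp
  finally show ?thesis .
qed

lemma zeta_trunc_snoc_Suc:
  assumes "N \<ge> 1"
  shows "zeta_trunc x (ks @ [k]) (Suc N) - zeta_trunc x (ks @ [k]) N
    = zeta_trunc x ks N / (real N + x) ^ k"
proof -
  have "{0<..<Suc N} = insert N {0<..<N}" using assms by auto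
  then show ?thesis by (simp add: zeta_trunc_snoc)
qed

lemma zeta_trunc_snoc_1 [simp]: "zeta_trunc x (ks @ [k]) (Suc 0) = 0"
proof -
  have "{0<..<Suc 0} = {}" by auto
  then show ?thesis by (simp add: zeta_trunc_snoc)
qed

text \<open>Induction on the last entry k. For k = 1 the increments are Q(log N) / N up to a
  summable error, so an antiderivative of Q gives the growth; for k >= 2 the increments are
  themselves summable and only a constant remains.\<close>

lemma zeta_trunc_expansion:
  assumes x: "\<bar>x\<bar> < 1" and "\<forall>k\<in>set ks. k > 0"
  shows "\<exists>Q. polylog_small (\<lambda>N. zeta_trunc x ks N - poly Q (ln (real N)))"
  using assms(2)
proof (induction ks rule: rev_induct)
  case Nil
  have "polylog_small (\<lambda>N. zeta_trunc x [] N - poly 1 (ln (real N)))" by simp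
  then show ?case ..
next
  case (snoc k ks)
  \<comment> \<open>From N + x >= N (1 - |x|) for N >= 1.\<close>
  define B where "B = 1 / (1 - \<bar>x\<bar>)"
  have B: "real N / (real N + x) \<le> B" "1 / (real N + x) \<le> B" "real N + x > 0" if "N \<ge> 1" for N
  proof -
    have N1: "real N \<ge> 1" using that by simp
    have "real N * \<bar>x\<bar> \<ge> \<bar>x\<bar>" using mult_right_mono[OF N1, of "\<bar>x\<bar>"] by simp
    then have "real N * (1 - \<bar>x\<bar>) \<le> real N + x"
      by (simp add: algebra_simps)
    moreover show pos: "real N + x > 0" using N1 x by linarith
    ultimately show "real N / (real N + x) \<le> B" using x by (simp add: B_def field_simps)
    have "1 / (real N + x) \<le> real N / (real N + x)" using N1 pos by (intro divide_right_mono) auto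
    also have "\<dots> \<le> B" by fact
    finally show "1 / (real N + x) \<le> B" .
  qed
  obtain Q where Q: "polylog_small (\<lambda>N. zeta_trunc x ks N - poly Q (ln (real N)))"
    using snoc by auto
  have Z: "polylog_bounded (zeta_trunc x ks)"
    using polylog_bounded_add[OF polylog_small_imp_bounded[OF Q]
        polylog_bounded_poly[OF polylog_bounded_ln, of Q]] by simp
  consider "k = 1" | "k \<ge> 2" using snoc.prems by fastforce
  then show ?case
  proof cases
    case 1
    obtain R where R: "pderiv R = Q" using pderiv_surj by blast
    define f where "f = (\<lambda>N. zeta_trunc x (ks @ [k]) N - poly R (ln (real N)))"
    have b: "polylog_bounded (\<lambda>N. - x * (real N / (real N + x)))"
      by (intro polylog_bounded_cmult polylog_bounded_const_bound[of _ B])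
        (use B in \<open>auto simp: abs_of_pos\<close>)
    have "polylog_bounded (\<lambda>N. real N ^ 2 * (f (Suc N) - f N))"
    proof (rule polylog_bounded_cong)
      \<comment> \<open>Three error sources: replacing 1 / (N + x) by 1 / N, the induction
        hypothesis, and the difference of R against its derivative.\<close>
      show "polylog_bounded (\<lambda>N. (- x * (real N / (real N + x))) * zeta_trunc x ks N
          + real N * (zeta_trunc x ks N - poly Q (ln (real N)))
          - real N ^ 2 * (poly R (ln (real (Suc N))) - poly R (ln (real N))
              - poly (pderiv R) (ln (real N)) / real N))"
        by (intro polylog_bounded_add polylog_bounded_diff polylog_bounded_mult b Z
            polylog_bounded_poly_ln_diff Q[unfolded polylog_small_def])
      fix N :: nat assume N: "N \<ge> 1"
      have "f (Suc N) - f N =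
          zeta_trunc x ks N / (real N + x) - (poly R (ln (real (Suc N))) - poly R (ln (real N)))"
        using zeta_trunc_snoc_Suc[OF N, of x ks k] 1 by (simp add: f_def)
      moreover have "real N ^ 2 * (z / (real N + x) - d) =
          (- x * (real N / (real N + x))) * z + real N * (z - q) - real N ^ 2 * (d - q / real N)"
        for z d q
      proof -
        define r where "r = real N / (real N + x)"
        have r: "real N * r = real N - x * r" using B(3)[OF N] by (simp add: r_def field_simps)
        have "real N ^ 2 * (z / (real N + x) - d) = (real N * r) * z - real N ^ 2 * d"
          by (simp add: r_def power2_eq_square algebra_simps)
        also have "\<dots> = (- x * r) * z + real N * (z - q) - real N ^ 2 * (d - q / real N)"
          unfolding r using N by (simp add: power2_eq_square algebra_simps)
        finally show ?thesis by (simp add: r_def)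
      qed
      ultimately show "real N ^ 2 * (f (Suc N) - f N) =
          (- x * (real N / (real N + x))) * zeta_trunc x ks N
          + real N * (zeta_trunc x ks N - poly Q (ln (real N)))
          - real N ^ 2 * (poly R (ln (real (Suc N))) - poly R (ln (real N))
              - poly (pderiv R) (ln (real N)) / real N)"
        by (simp add: R)
    qed
    then obtain c where "polylog_small (\<lambda>N. f N - c)" using polylog_tail by blast
    then have "polylog_small (\<lambda>N. zeta_trunc x (ks @ [k]) N - poly (R + [:c:]) (ln (real N)))"
      by (simp add: f_def algebra_simps)
    then show ?thesis ..
  next
    case 2
    \<comment> \<open>Two of the k factors 1 / (N + x) absorb N^2; the remaining k - 2 are merely
      bounded.\<close>
    have b: "polylog_bounded (\<lambda>N. (real N / (real N + x)) ^ 2 * (1 / (real N + x)) ^ (k - 2))"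
      by (intro polylog_bounded_mult polylog_bounded_power polylog_bounded_const_bound[of _ B])
        (use B in \<open>auto simp: abs_of_pos\<close>)
    have "polylog_bounded (\<lambda>N. real N ^ 2 *
        (zeta_trunc x (ks @ [k]) (Suc N) - zeta_trunc x (ks @ [k]) N))"
    proof (rule polylog_bounded_cong[OF polylog_bounded_mult[OF b Z]])
      fix N :: nat assume N: "N \<ge> 1"
      have "(real N + x) ^ k = (real N + x) ^ 2 * (real N + x) ^ (k - 2)"
        using 2 by (metis le_add_diff_inverse power_add)
      then show "real N ^ 2 * (zeta_trunc x (ks @ [k]) (Suc N) - zeta_trunc x (ks @ [k]) N) =
          (real N / (real N + x)) ^ 2 * (1 / (real N + x)) ^ (k - 2) * zeta_trunc x ks N"
        unfolding zeta_trunc_snoc_Suc[OF N] using B(3)[OF N] by (simp add: field_simps)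
    qed
    then obtain c where "polylog_small (\<lambda>N. zeta_trunc x (ks @ [k]) N - c)"
      using polylog_tail[of "zeta_trunc x (ks @ [k])"] by blast
    then have "polylog_small (\<lambda>N. zeta_trunc x (ks @ [k]) N - poly [:c:] (ln (real N)))" by simp
    then show ?thesis ..
  qed
qed

section \<open>The Gamma factor and harmonic products\<close>

text \<open>Pascal's rule, as needed for the inductive step of Leibniz' rule: the right side is the
  derivative of the convolution of order n when u and v are sequences of successive
  derivatives.\<close>

lemma binomial_convolution_Suc:
  fixes u v :: "nat \<Rightarrow> 'a :: comm_semiring_1"
  shows "(\<Sum>k\<le>Suc n. of_nat (Suc n choose k) * u k * v (Suc n - k)) =
    (\<Sum>k\<le>n. of_nat (n choose k) * (u k * v (Suc (n - k)) + u (Suc k) * v (n - k)))"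
proof -
  have "(\<Sum>k\<le>Suc n. of_nat (Suc n choose k) * u k * v (Suc n - k)) =
      (u 0 * v (Suc n) + (\<Sum>k\<le>n. of_nat (n choose Suc k) * u (Suc k) * v (n - k)))
      + (\<Sum>k\<le>n. of_nat (n choose k) * u (Suc k) * v (n - k))"
    by (simp add: sum.atMost_Suc_shift sum.distrib algebra_simps del: sum.atMost_Suc)
  also have "u 0 * v (Suc n) + (\<Sum>k\<le>n. of_nat (n choose Suc k) * u (Suc k) * v (n - k)) =
      (\<Sum>k\<le>Suc n. of_nat (n choose k) * u k * v (Suc n - k))"
    by (simp add: sum.atMost_Suc_shift del: sum.atMost_Suc)
  also have "\<dots> = (\<Sum>k\<le>n. of_nat (n choose k) * u k * v (Suc (n - k)))"
    by (simp add: Suc_diff_le binomial_eq_0)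
  finally show ?thesis by (simp add: sum.distrib algebra_simps)
qed

text \<open>The k-th derivative of gamma + psi(1 + y), the logarithmic derivative of exp (gamma y)
  Gamma(1 + y); the constant gamma survives only for k = 0.\<close>

definition shifted_Polygamma :: "nat \<Rightarrow> real \<Rightarrow> real" where
  "shifted_Polygamma k y = (if k = 0 then euler_mascheroni else 0) + Polygamma k (1 + y)"

lemma has_field_derivative_shifted_Polygamma:
  assumes "y > -1"
  shows "(shifted_Polygamma k has_field_derivative shifted_Polygamma (Suc k) y) (at y)"
  unfolding shifted_Polygamma_def[abs_def] using assms
  by (auto intro!: derivative_eq_intros elim!: nonpos_Ints_cases)

text \<open>The derivatives of \<open>e\<^sup>\<gamma>\<^sup>y \<Gamma>(1 + y)\<close>, by Leibniz' rule from its logarithmic derivative.\<close>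

fun A_deriv :: "nat \<Rightarrow> real \<Rightarrow> real" where
  "A_deriv 0 y = exp (euler_mascheroni * y) * Gamma (1 + y)"
| "A_deriv (Suc n) y = (\<Sum>k\<le>n. of_nat (n choose k) * shifted_Polygamma k y * A_deriv (n - k) y)"

lemma has_field_derivative_A_deriv:
  assumes y: "y > -1"
  shows "(A_deriv n has_field_derivative A_deriv (Suc n) y) (at y)"
proof (induction n rule: less_induct)
  case (less n)
  show ?case
  proof (cases n)
    case 0
    have "1 + y \<notin> \<int>\<^sub>\<le>\<^sub>0" using y by (auto elim!: nonpos_Ints_cases)
    then have "((\<lambda>y. exp (euler_mascheroni * y) * Gamma (1 + y)) has_field_derivative
        shifted_Polygamma 0 y * (exp (euler_mascheroni * y) * Gamma (1 + y))) (at y)"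
      by (auto intro!: derivative_eq_intros simp: shifted_Polygamma_def algebra_simps)
    moreover have "A_deriv 0 = (\<lambda>y. exp (euler_mascheroni * y) * Gamma (1 + y))"
      by (rule ext) simp
    ultimately show ?thesis using 0 by simp
  next
    case (Suc m)
    have eq: "A_deriv (Suc m) =
        (\<lambda>y. \<Sum>k\<le>m. of_nat (m choose k) * (shifted_Polygamma k y * A_deriv (m - k) y))"
      by (rule ext) (simp add: mult.assoc)
    have "(A_deriv (Suc m) has_field_derivative
       (\<Sum>k\<le>m. of_nat (m choose k) * (shifted_Polygamma k y * A_deriv (Suc (m - k)) y
          + shifted_Polygamma (Suc k) y * A_deriv (m - k) y))) (at y)"
      unfolding eq
    proof (intro DERIV_sum DERIV_cmult)
      fix k assume "k \<in> {..m}"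
      then have "m - k < n" using Suc by auto
      then show "((\<lambda>y. shifted_Polygamma k y * A_deriv (m - k) y) has_field_derivative
          (shifted_Polygamma k y * A_deriv (Suc (m - k)) y
            + shifted_Polygamma (Suc k) y * A_deriv (m - k) y)) (at y)"
        using DERIV_mult[OF has_field_derivative_shifted_Polygamma[OF y, of k] less.IH[of "m - k"]]
        by (simp add: add.commute mult.commute del: A_deriv.simps)
    qed
    also have "(\<Sum>k\<le>m. of_nat (m choose k) * (shifted_Polygamma k y * A_deriv (Suc (m - k)) y
          + shifted_Polygamma (Suc k) y * A_deriv (m - k) y)) = A_deriv (Suc (Suc m)) y"
      unfolding A_deriv.simps(2)[of "Suc m"]
      by (rule binomial_convolution_Suc[symmetric, of m "\<lambda>k. shifted_Polygamma k y"
            "\<lambda>k. A_deriv k y"])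
    finally show ?thesis using Suc by simp
  qed
qed

text \<open>Only y = 0 is needed later, but each differentiation requires the previous identity on a
  neighbourhood, hence the open ray.\<close>

lemma higher_deriv_A:
  assumes "y > -1"
  shows "(deriv ^^ n) (\<lambda>y. exp (euler_mascheroni * y) * Gamma (1 + y)) y = A_deriv n y"
  using assms
proof (induction n arbitrary: y)
  case (Suc n)
  have "((deriv ^^ n) (\<lambda>y. exp (euler_mascheroni * y) * Gamma (1 + y))
      has_field_derivative A_deriv (Suc n) y) (at y)"
    by (rule has_field_derivative_transform_within_open[OF has_field_derivative_A_deriv,
          where S = "{-1<..}"]) (use Suc in auto)
  then show ?case by (simp add: DERIV_imp_deriv del: A_deriv.simps)
qed simp

lemma A_fps_nth: "fps_nth A_fps n = A_deriv n 0 / fact n"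
  by (simp add: A_fps_def higher_deriv_A)

text \<open>The Taylor series of gamma + psi(1 + y) at 0.\<close>

definition A_logderiv :: "real fps" where
  "A_logderiv = Abs_fps (\<lambda>k. shifted_Polygamma k 0 / fact k)"

text \<open>The recursion for \<open>A_deriv\<close> at 0, divided by n!, is exactly this Cauchy
  product.\<close>

lemma fps_deriv_A_fps: "fps_deriv A_fps = A_logderiv * A_fps"
proof (rule fps_ext)
  fix n
  have "fps_nth (fps_deriv A_fps) n = A_deriv (Suc n) 0 / fact n"
    by (simp add: A_fps_nth del: A_deriv.simps of_nat_Suc)
  also have "\<dots> = (\<Sum>k\<le>n. (shifted_Polygamma k 0 / fact k) * (A_deriv (n - k) 0 / fact (n - k)))"
    unfolding A_deriv.simps(2) sum_divide_distrib
    by (intro sum.cong) (auto simp: binomial_fact)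
  finally show "fps_nth (fps_deriv A_fps) n = fps_nth (A_logderiv * A_fps) n"
    by (simp add: fps_mult_nth A_fps_nth A_logderiv_def atLeast0AtMost)
qed

section \<open>Harmonic products and their logarithmic derivatives\<close>

definition harm_fps :: "nat \<Rightarrow> real fps" where
  "harm_fps N = (\<Prod>j=1..N. 1 + fps_const (1 / real j) * fps_X)"

text \<open>The sum of 1 / (j + y) over 1 <= j <= N, expanded in geometric series in y.\<close>

definition harm_logderiv :: "nat \<Rightarrow> real fps" where
  "harm_logderiv N = Abs_fps (\<lambda>k. (-1) ^ k * (\<Sum>j=1..N. 1 / real j ^ Suc k))"

lemma harm_fps_Suc: "harm_fps (Suc N) = (1 + fps_const (1 / real (Suc N)) * fps_X) * harm_fps N"
  by (simp add: harm_fps_def mult.commute)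

lemma harm_fps_nth_0 [simp]: "fps_nth (harm_fps N) 0 = 1"
  by (induction N) (simp add: harm_fps_def, simp add: harm_fps_Suc)

lemma fps_deriv_harm_fps: "fps_deriv (harm_fps N) = harm_logderiv N * harm_fps N"
proof (induction N)
  case 0
  have "harm_logderiv 0 = 0" by (simp add: harm_logderiv_def fps_eq_iff)
  then show ?case by (simp add: harm_fps_def)
next
  case (Suc N)
  define c where "c = 1 / real (Suc N)"
  \<comment> \<open>The geometric series of c / (1 + c y), contributed by the new factor 1 + c
    y.\<close>
  define q where "q = Abs_fps (\<lambda>k. (-1) ^ k * c ^ Suc k)"
  have q: "q * (1 + fps_const c * fps_X) = fps_const c"
  proof (rule fps_ext)
    fix n show "fps_nth (q * (1 + fps_const c * fps_X)) n = fps_nth (fps_const c) n"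
      by (cases n) (auto simp: q_def distrib_left mult.assoc[symmetric] mult.commute[of _ "fps_const c"])
  qed
  have D: "harm_logderiv (Suc N) = harm_logderiv N + q"
    by (simp add: fps_eq_iff harm_logderiv_def q_def c_def algebra_simps power_divide)
  have "harm_logderiv (Suc N) * harm_fps (Suc N) =
      (1 + fps_const c * fps_X) * (harm_logderiv N * harm_fps N)
      + (q * (1 + fps_const c * fps_X)) * harm_fps N"
    unfolding D harm_fps_Suc c_def[symmetric] by (simp add: algebra_simps)
  also have "\<dots> = fps_deriv (harm_fps (Suc N))"
    unfolding harm_fps_Suc c_def[symmetric] by (simp add: Suc.IH q)
  finally show ?case ..
qed

text \<open>Since psi(1) = - gamma, the Gamma factor contributes nothing to the constant
  term.\<close>

lemma logderiv_nth_0: "fps_nth (A_logderiv + harm_logderiv N) 0 = harm N"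
  by (simp add: A_logderiv_def harm_logderiv_def shifted_Polygamma_def harm_def field_simps)

lemma polylog_small_harm: "polylog_small (\<lambda>N. harm N - (ln (real N) + euler_mascheroni))"
proof -
  have "polylog_small (\<lambda>N. (harm N - ln (real N)) - euler_mascheroni)"
  proof (rule polylog_tail_limit[OF polylog_bounded_const_bound[of _ 2] euler_mascheroni_LIMSEQ])
    fix N :: nat assume N: "N \<ge> 1"
    let ?d = "ln (real (Suc N)) - ln (real N) - 1 / real N"
    \<comment> \<open>The increment 1 / (N + 1) - (log (N + 1) - log N) is regrouped around 1 / N;
      each part is at most 1 in absolute value after multiplication by N^2.\<close>
    have "real N ^ 2 * (harm (Suc N) - ln (real (Suc N)) - (harm N - ln (real N))) =
        - (real N / (real N + 1)) - real N ^ 2 * ?d"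
    proof -
      have "real N ^ 2 * (1 / (real N + 1) - 1 / real N) = - (real N / (real N + 1))"
      proof -
        have "real N \<noteq> 0" "real N + 1 \<noteq> 0" using N by auto
        then show ?thesis by (simp add: divide_simps power2_eq_square)
      qed
      then show ?thesis by (simp add: harm_Suc algebra_simps inverse_eq_divide)
    qed
    moreover have "\<bar>real N ^ 2 * ?d\<bar> \<le> 1"
      using N mult_left_mono[OF ln_Suc_diff(2)[of N], of "real N ^ 2"] by (simp add: abs_mult)
    moreover have "real N / (real N + 1) \<le> 1" "real N / (real N + 1) \<ge> 0" by auto
    ultimately show "\<bar>real N ^ 2 * (harm (Suc N) - ln (real (Suc N)) - (harm N - ln (real N)))\<bar> \<le> 2"
      by linarith
  qed
  then show ?thesis by (simp add: algebra_simps)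
qed

text \<open>For k >= 1 the Gamma factor contributes (-1)^(k+1) zeta(k+1) and the product (-1)^k
  times a partial sum of zeta(k+1). Up to sign, only the tail of that zeta series is left.\<close>

lemma polylog_small_logderiv_nth:
  assumes "k \<ge> 1"
  shows "polylog_small (\<lambda>N. fps_nth (A_logderiv + harm_logderiv N) k)"
proof -
  define f where "f = (\<lambda>N. \<Sum>j=1..N. 1 / real j ^ Suc k)"
  define z where "z = (-1) ^ Suc k * Polygamma k (1::real) / fact k"
  have "(\<lambda>j. inverse ((1 + of_nat j) ^ Suc k)) sums z"
    unfolding z_def by (rule Polygamma_LIMSEQ) (use assms in auto)
  moreover have "(\<Sum>j<N. inverse ((1 + real j) ^ Suc k)) = f N" for N
    unfolding f_def by (rule sum.reindex_bij_witness[of _ "\<lambda>j. j - 1" Suc]) (auto simp: field_simps)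
  ultimately have lim: "f \<longlonglongrightarrow> z" by (simp add: sums_def)
  have "polylog_small (\<lambda>N. f N - z)"
  proof (rule polylog_tail_limit[OF polylog_bounded_const_bound[of _ 1] lim])
    fix N :: nat assume N: "N \<ge> 1"
    have "real N ^ 2 \<le> real (Suc N) ^ 2" by (intro power_mono) auto
    also have "\<dots> \<le> real (Suc N) ^ Suc k" using assms by (intro power_increasing) auto
    finally show "\<bar>real N ^ 2 * (f (Suc N) - f N)\<bar> \<le> 1"
      by (simp add: f_def del: power_Suc)
  qed
  from polylog_small_cmult[OF this, of "(-1) ^ k"] show ?thesis
    using assms by (simp add: A_logderiv_def harm_logderiv_def shifted_Polygamma_def f_def z_def
        algebra_simps flip: power_mult_distrib)
qed

text \<open>The product \<open>A(y) \<Prod>\<^sub>j\<^sub>\<le>\<^sub>N (1 + y / j)\<close> is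
  \<open>exp (\<gamma> y) \<Gamma>(N + 1 + y) / N!\<close>, which Stirling's formula compares with
  \<open>exp ((log N + \<gamma>) y)\<close>; coefficientwise it suffices to compare logarithmic derivatives.\<close>

lemma polylog_small_A_harm_nth:
  "polylog_small (\<lambda>N. fps_nth (A_fps * harm_fps N) n
     - (ln (real N) + euler_mascheroni) ^ n / fact n)"
proof (induction n rule: less_induct)
  case (less n)
  define \<Psi> where "\<Psi> = (\<lambda>N. A_logderiv + harm_logderiv N)"
  define G where "G = (\<lambda>N. A_fps * harm_fps N)"
  define l where "l = (\<lambda>N. ln (real N) + euler_mascheroni)"
  have deriv: "fps_deriv (G N) = \<Psi> N * G N" for N
    by (simp add: G_def \<Psi>_def fps_deriv_A_fps fps_deriv_harm_fps algebra_simps)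
  have l: "polylog_bounded l" unfolding l_def by (intro polylog_bounded_add) auto
  have IH: "polylog_small (\<lambda>N. fps_nth (G N) m - l N ^ m / fact m)" if "m < n" for m
    using less[OF that] by (simp add: G_def l_def)
  have G: "polylog_bounded (\<lambda>N. fps_nth (G N) m)" if "m < n" for m
    using polylog_bounded_add[OF polylog_small_imp_bounded[OF IH[OF that]]
        polylog_bounded_cmult[OF polylog_bounded_power[OF l], of "1 / fact m" m]]
    by simp
  show ?case
  proof (cases n)
    case 0
    then show ?thesis by (simp add: A_fps_nth)
  next
    case (Suc m)
    \<comment> \<open>Comparing coefficients in G' = \<Psi> G expresses (m + 1) G_(m+1) through
      lower ones. The constant term of \<Psi> is H_N, close to l, and yields the main term; all its
      other coefficients are small.\<close>
    have "polylog_small (\<lambda>N. (1 / real (Suc m)) * (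
        fps_nth (G N) m * (fps_nth (\<Psi> N) 0 - l N) + l N * (fps_nth (G N) m - l N ^ m / fact m)
        + (\<Sum>i=1..m. fps_nth (G N) (m - i) * fps_nth (\<Psi> N) i)))"
      using polylog_small_harm
      by (intro polylog_small_cmult polylog_small_add polylog_small_mult polylog_small_sum G l IH)
        (auto simp: Suc \<Psi>_def logderiv_nth_0 l_def simp del: fps_add_nth
          intro!: polylog_small_logderiv_nth)
    then have "polylog_small (\<lambda>N. fps_nth (G N) (Suc m) - l N ^ Suc m / fact (Suc m))"
    proof (rule polylog_small_cong)
      fix N :: nat
      have "real (Suc m) * fps_nth (G N) (Suc m) = (\<Sum>i=0..m. fps_nth (\<Psi> N) i * fps_nth (G N) (m - i))"
        using arg_cong[OF deriv[of N], of "\<lambda>F. fps_nth F m"] by (simp add: fps_mult_nth)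
      also have "\<dots> = fps_nth (\<Psi> N) 0 * fps_nth (G N) m
          + (\<Sum>i=1..m. fps_nth (G N) (m - i) * fps_nth (\<Psi> N) i)"
        by (subst sum.atLeast_Suc_atMost) (auto simp: mult.commute)
      finally have "real (Suc m) * fps_nth (G N) (Suc m) - l N * l N ^ m / fact m =
         fps_nth (G N) m * (fps_nth (\<Psi> N) 0 - l N) + l N * (fps_nth (G N) m - l N ^ m / fact m)
        + (\<Sum>i=1..m. fps_nth (G N) (m - i) * fps_nth (\<Psi> N) i)"
        by (simp add: algebra_simps)
      then show "fps_nth (G N) (Suc m) - l N ^ Suc m / fact (Suc m) = (1 / real (Suc m)) * (
        fps_nth (G N) m * (fps_nth (\<Psi> N) 0 - l N) + l N * (fps_nth (G N) m - l N ^ m / fact m)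
        + (\<Sum>i=1..m. fps_nth (G N) (m - i) * fps_nth (\<Psi> N) i))"
        by (simp add: field_simps del: of_nat_Suc)
    qed
    then show ?thesis by (simp add: Suc G_def l_def)
  qed
qed

section \<open>Size of the coefficients of the harmonic products\<close>

lemma harm_fps_0: "harm_fps 0 = 1"
  by (simp add: harm_fps_def)

lemma harm_fps_nth_Suc_Suc:
  "fps_nth (harm_fps (Suc N)) (Suc n) =
     fps_nth (harm_fps N) (Suc n) + fps_nth (harm_fps N) n / real (Suc N)"
  by (simp add: harm_fps_Suc distrib_right mult.assoc)

lemma harm_fps_nth_nonneg: "fps_nth (harm_fps N) n \<ge> 0"
proof (induction N arbitrary: n)
  case (Suc N)
  then show ?case by (cases n) (auto simp: harm_fps_nth_Suc_Suc)
qed (simp add: harm_fps_0)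

text \<open>The bound reproduces itself: it makes each increment in N at most 1. It is crude, but it
  suffices for convergence of the power series on |t| < 1.\<close>

lemma harm_fps_nth_le: "fps_nth (harm_fps N) n \<le> real (Suc N)"
proof (induction N arbitrary: n)
  case (Suc N)
  show ?case
  proof (cases n)
    case (Suc m)
    have "fps_nth (harm_fps N) m / real (Suc N) \<le> 1"
      using Suc.IH[of m] by (simp add: field_simps)
    moreover have "fps_nth (harm_fps N) n \<le> real (Suc N)" by (rule Suc.IH)
    ultimately show ?thesis
      unfolding Suc harm_fps_nth_Suc_Suc of_nat_Suc[of "Suc N"] by linarith
  qed simp
qed (simp add: harm_fps_0)

lemma harm_fps_nth_1: "fps_nth (harm_fps N) (Suc 0) = harm N"
  by (induction N) (simp_all add: harm_fps_0 harm_fps_nth_Suc_Suc harm_Suc harm_expand(1) inverse_eq_divide)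

text \<open>The coefficient is the n-th elementary symmetric polynomial in 1, 1/2, ..., 1/N, all of
  whose monomials occur in the expansion of the n-th power of the sum H_N.\<close>

lemma harm_fps_nth_le_power: "fps_nth (harm_fps N) n \<le> harm N ^ n"
proof (induction N arbitrary: n)
  case 0
  then show ?case by (cases n) (auto simp: harm_fps_0 harm_expand(1))
next
  case (Suc N)
  show ?case
  proof (cases n)
    case (Suc m)
    define c where "c = 1 / real (Suc N)"
    have h: "harm (Suc N) = harm N + c" "harm N \<ge> (0::real)" "c \<ge> 0"
      by (simp_all add: harm_Suc c_def inverse_eq_divide harm_nonneg)
    have "fps_nth (harm_fps (Suc N)) n \<le> harm N ^ Suc m + c * harm N ^ m"
      using add_mono[OF Suc.IH[of "Suc m"] mult_left_mono[OF Suc.IH[of m] h(3)]]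
      by (simp add: Suc harm_fps_nth_Suc_Suc c_def)
    also have "\<dots> = (harm N + c) * harm N ^ m" by (simp add: algebra_simps)
    also have "\<dots> \<le> (harm N + c) * (harm N + c) ^ m"
      using h by (intro mult_left_mono power_mono) auto
    finally show ?thesis by (simp add: h(1) Suc)
  qed simp
qed

lemma polylog_bounded_harm_fps_nth: "polylog_bounded (\<lambda>N. fps_nth (harm_fps N) n)"
proof (rule polylog_bounded_mono)
  have "polylog_bounded (\<lambda>N. harm N - (ln (real N) + euler_mascheroni) + (ln (real N) + euler_mascheroni))"
    by (intro polylog_bounded_add polylog_small_imp_bounded[OF polylog_small_harm]) auto
  then show "polylog_bounded (\<lambda>N. harm N ^ n)" by (intro polylog_bounded_power) simp
  show "\<bar>fps_nth (harm_fps N) n\<bar> \<le> \<bar>harm N ^ n\<bar>" for N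
    using harm_fps_nth_le_power[of N n] harm_fps_nth_nonneg[of N n] by linarith
qed

text \<open>In the product e_1 e_m of elementary symmetric polynomials, squarefree monomials give (m
  + 1) e_(m+1). Those with a repeated variable 1/j <= 1 are at most the monomial with one copy
  removed, and each monomial of e_m arises in m ways.\<close>

lemma harm_mult_harm_fps_nth:
  "harm N * fps_nth (harm_fps N) m \<le>
     real (Suc m) * fps_nth (harm_fps N) (Suc m) + real m * fps_nth (harm_fps N) m"
proof (induction N arbitrary: m)
  case 0
  then show ?case by (simp add: harm_fps_0 harm_expand(1))
next
  case (Suc N)
  define c where "c = 1 / real (Suc N)"
  have c: "c \<ge> 0" "c \<le> 1" by (auto simp: c_def)
  have h: "harm (Suc N) = harm N + c" by (simp add: harm_Suc c_def inverse_eq_divide)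
  show ?case
  proof (cases m)
    case 0
    then show ?thesis
      using harm_fps_nth_1[of "Suc N"] by simp
  next
    case (Suc k)
    define e where "e = fps_nth (harm_fps N)"
    have e: "fps_nth (harm_fps (Suc N)) (Suc j) = e (Suc j) + c * e j" for j
      by (simp add: harm_fps_nth_Suc_Suc e_def c_def)
    have "c * (harm N * e k) \<le> c * (real (Suc k) * e (Suc k) + real k * e k)"
      using Suc.IH[of k] c by (intro mult_left_mono) (auto simp: e_def)
    moreover have "harm N * e m \<le> real (Suc m) * e (Suc m) + real m * e m"
      using Suc.IH[of m] by (simp add: e_def)
    \<comment> \<open>The repeated variable: here 1 / (N + 1) <= 1 enters.\<close>
    moreover have "c * (c * e k) \<le> c * e k"
      using c harm_fps_nth_nonneg[of N k] by (intro mult_left_mono) (auto simp: e_def mult_left_le_one_le)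
    ultimately have "(harm N + c) * (e m + c * e k) \<le>
        real (Suc m) * (e (Suc m) + c * e m) + real m * (e m + c * e k)"
      by (simp add: Suc algebra_simps)
    then show ?thesis unfolding h e Suc by (simp add: Suc)
  qed
qed

text \<open>Powers of H_N are traded for the coefficients e_(N,m), whose generating functions are
  known in closed form. Multiplying by 1 + H_N raises the largest m by one.\<close>

lemma power_harm_le_harm_fps:
  "\<exists>C\<ge>0. \<forall>N. (1 + harm N) ^ p \<le> C * (\<Sum>m\<le>p. fps_nth (harm_fps N) m)"
proof (induction p)
  case 0
  then show ?case by (intro exI[of _ 1]) simp
next
  case (Suc p)
  then obtain C where C: "C \<ge> 0" "\<And>N. (1 + harm N) ^ p \<le> C * (\<Sum>m\<le>p. fps_nth (harm_fps N) m)"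
    by blast
  define K where "K = real (Suc p)"
  show ?case
  proof (intro exI[of _ "C * (2 * K)"] conjI allI)
    show "C * (2 * K) \<ge> 0" using C by (simp add: K_def)
    fix N
    let ?e = "fps_nth (harm_fps N)"
    have "(1 + harm N) ^ Suc p \<le> (1 + harm N) * (C * (\<Sum>m\<le>p. ?e m))"
      using C(2)[of N] by (simp add: mult_left_mono harm_nonneg)
    also have "\<dots> = C * (\<Sum>m\<le>p. (1 + harm N) * ?e m)" by (simp add: sum_distrib_left mult_ac)
    finally have *: "(1 + harm N) ^ Suc p \<le> C * (\<Sum>m\<le>p. (1 + harm N) * ?e m)" .
    have "(\<Sum>m\<le>p. (1 + harm N) * ?e m) \<le> (\<Sum>m\<le>p. K * ?e (Suc m) + K * ?e m)"
    proof (rule sum_mono)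
      fix m assume "m \<in> {..p}"
      then have "real (Suc m) * ?e (Suc m) \<le> K * ?e (Suc m)" "real (Suc m) * ?e m \<le> K * ?e m"
        by (auto simp: K_def intro!: mult_right_mono harm_fps_nth_nonneg)
      then show "(1 + harm N) * ?e m \<le> K * ?e (Suc m) + K * ?e m"
        using harm_mult_harm_fps_nth[of N m] by (simp add: algebra_simps)
    qed
    also have "\<dots> = K * (\<Sum>m\<le>p. ?e (Suc m)) + K * (\<Sum>m\<le>p. ?e m)"
      by (simp add: sum.distrib sum_distrib_left)
    also have "\<dots> \<le> K * (\<Sum>m\<le>Suc p. ?e m) + K * (\<Sum>m\<le>Suc p. ?e m)"
    proof (intro add_mono mult_left_mono)
      show "(\<Sum>m\<le>p. ?e (Suc m)) \<le> (\<Sum>m\<le>Suc p. ?e m)"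
        by (subst sum.atMost_Suc_shift) (simp add: harm_fps_nth_nonneg)
    qed (auto simp: K_def harm_fps_nth_nonneg)
    finally have "(\<Sum>m\<le>p. (1 + harm N) * ?e m) \<le> 2 * K * (\<Sum>m\<le>Suc p. ?e m)"
      by (simp add: mult.assoc)
    from * mult_left_mono[OF this C(1)]
    show "(1 + harm N) ^ Suc p \<le> C * (2 * K) * (\<Sum>m\<le>Suc p. ?e m)"
      by (simp only: mult.assoc)
  qed
qed

text \<open>The index shift suits the error estimate: dividing by M + 1 leaves e_(M,m) / (M + 1) as
  the coefficient of t^(M+1), which is an integrated generating function.\<close>

lemma polylog_bounded_le_harm_fps:
  assumes "polylog_bounded f"
  obtains C p where "C \<ge> 0" "\<And>M. \<bar>f (Suc M)\<bar> \<le> C * (\<Sum>m\<le>p. fps_nth (harm_fps M) m)"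
proof -
  obtain C p where f: "C \<ge> 0" "\<And>N. N \<ge> 1 \<Longrightarrow> \<bar>f N\<bar> \<le> C * (1 + ln (real N)) ^ p"
    using polylog_boundedE[OF assms] by blast
  obtain D where D: "D \<ge> 0" "\<And>N. (1 + harm N) ^ p \<le> D * (\<Sum>m\<le>p. fps_nth (harm_fps N) m)"
    using power_harm_le_harm_fps[of p] by blast
  show ?thesis
  proof (rule that[of "C * (2 ^ p * D)" p])
    show "C * (2 ^ p * D) \<ge> 0" using f D by simp
    fix M
    have "ln (real (Suc M)) \<le> harm M + 1"
      using ln_le_harm[of M] harm_nonneg[of M, where 'a = real] by (simp add: add.commute)
    then have "1 + ln (real (Suc M)) \<le> 2 * (1 + harm M)"
      using harm_nonneg[of M, where 'a = real] by simp
    then have "(1 + ln (real (Suc M))) ^ p \<le> (2 * (1 + harm M)) ^ p"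
      by (rule power_mono) simp
    also have "\<dots> = 2 ^ p * (1 + harm M) ^ p" by (simp only: power_mult_distrib)
    also have "\<dots> \<le> 2 ^ p * (D * (\<Sum>m\<le>p. fps_nth (harm_fps M) m))"
      using D(2) by (intro mult_left_mono) auto
    finally have "C * (1 + ln (real (Suc M))) ^ p \<le>
        C * (2 ^ p * (D * (\<Sum>m\<le>p. fps_nth (harm_fps M) m)))"
      using f(1) by (rule mult_left_mono)
    then show "\<bar>f (Suc M)\<bar> \<le> C * (2 ^ p * D) * (\<Sum>m\<le>p. fps_nth (harm_fps M) m)"
      using f(2)[of "Suc M"] by (simp add: mult.assoc)
  qed
qed

section \<open>Generating functions of the harmonic coefficients\<close>

lemma summable_harm_fps_nth:
  assumes "\<bar>t\<bar> < 1"
  shows "summable (\<lambda>M. fps_nth (harm_fps M) n * t ^ M)"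
proof (rule summable_comparison_test')
  \<comment> \<open>The series with coefficients M + 1 is the derivative of the geometric
    series.\<close>
  have "summable (\<lambda>M. diffs (\<lambda>_. 1) M * \<bar>t\<bar> ^ M)"
    by (rule termdiff_converges[of _ 1]) (use assms in \<open>auto simp: summable_geometric\<close>)
  then show "summable (\<lambda>M. real (Suc M) * \<bar>t\<bar> ^ M)"
    by (simp add: diffs_def)
  fix M :: nat
  show "norm (fps_nth (harm_fps M) n * t ^ M) \<le> real (Suc M) * \<bar>t\<bar> ^ M"
    using harm_fps_nth_nonneg[of M n] harm_fps_nth_le[of M n]
    by (simp add: abs_mult power_abs mult_right_mono del: of_nat_Suc)
qed

text \<open>Termwise integration: both sides vanish at 0 and have the same derivative on (-1, 1).
  Stated separately because it serves both the induction for \<open>harm_fps_sums\<close> and the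
  error bound for Abel means.\<close>

lemma harm_fps_sums_integral:
  fixes t :: real
  assumes t: "\<bar>t\<bar> < 1"
    and sums: "\<And>u. \<bar>u\<bar> < 1 \<Longrightarrow>
      (\<lambda>M. fps_nth (harm_fps M) n * u ^ M) sums ((- ln (1 - u)) ^ n / fact n / (1 - u))"
  shows "(\<lambda>M. fps_nth (harm_fps M) n / real (Suc M) * t ^ Suc M)
    sums ((- ln (1 - t)) ^ Suc n / fact (Suc n))"
proof -
  define f where "f = (\<lambda>M. fps_nth (harm_fps M) n / real (Suc M))"
  define F where "F = (\<lambda>u::real. \<Sum>M. f M * u ^ Suc M)"
  define g where "g = (\<lambda>u::real. (- ln (1 - u)) ^ Suc n / fact (Suc n))"
  have f: "f M * real (Suc M) = fps_nth (harm_fps M) n" for M by (simp add: f_def)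
  have DF: "(F has_real_derivative ((- ln (1 - u)) ^ n / fact n / (1 - u))) (at u)"
    if u: "\<bar>u\<bar> < 1" for u
  proof -
    have "(F has_real_derivative (\<Sum>M. f M * real (Suc M) * u ^ M)) (at u)"
      unfolding F_def
      by (rule DERIV_power_series'[where R = 1])
        (use u in \<open>auto simp only: f greaterThanLessThan_iff abs_less_iff intro!: summable_harm_fps_nth\<close>)
    then show ?thesis using sums[OF u] by (simp only: f sums_iff)
  qed
  have Dg: "(g has_real_derivative ((- ln (1 - u)) ^ n / fact n / (1 - u))) (at u)"
    if u: "\<bar>u\<bar> < 1" for u
  proof -
    have "(g has_real_derivative (real (Suc n) * (- ln (1 - u)) ^ n * (1 / (1 - u)) / fact (Suc n))) (at u)"
      unfolding g_def using u by (auto intro!: derivative_eq_intros simp del: power_Suc fact_Suc)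
    also have "real (Suc n) * (- ln (1 - u)) ^ n * (1 / (1 - u)) / fact (Suc n) =
        (- ln (1 - u)) ^ n / fact n / (1 - u)"
      by (simp del: of_nat_Suc)
    finally show ?thesis .
  qed
  have "\<exists>c. \<forall>u\<in>{-1<..<1}. F u - g u = c"
    by (rule has_field_derivative_zero_constant)
      (auto intro!: derivative_eq_intros DERIV_subset[OF DF] DERIV_subset[OF Dg] simp: abs_less_iff)
  then obtain c where c: "\<And>u. u \<in> {-1<..<1} \<Longrightarrow> F u - g u = c" by blast
  have "F 0 - g 0 = 0" by (simp add: F_def g_def)
  then have "F t = g t" using c[of 0] c[of t] t by (auto simp: abs_less_iff)
  moreover have "summable (\<lambda>M. f M * t ^ Suc M)"
  proof (rule summable_comparison_test')
    show "summable (\<lambda>M. fps_nth (harm_fps M) n * \<bar>t\<bar> ^ M)"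
      using t by (intro summable_harm_fps_nth) auto
    fix M :: nat
    have "f M \<ge> 0" using harm_fps_nth_nonneg by (simp add: f_def)
    moreover have "f M \<le> fps_nth (harm_fps M) n"
      using harm_fps_nth_nonneg[of M n] by (simp add: f_def divide_le_eq mult_le_cancel_left1)
    moreover have "\<bar>t\<bar> ^ Suc M \<le> \<bar>t\<bar> ^ M" using t by (intro power_decreasing) auto
    ultimately show "norm (f M * t ^ Suc M) \<le> fps_nth (harm_fps M) n * \<bar>t\<bar> ^ M"
      by (simp add: abs_mult power_abs mult_mono del: power_Suc)
  qed
  ultimately show ?thesis unfolding F_def f_def g_def using summable_sums by metis
qed

text \<open>Coefficientwise form of the binomial series of (1 - t)^(-1-y). Multiplying by 1 - t
  replaces e_(M,n+1) by its increments e_(M,n) / (M + 1), which form the integral of the preceding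
  case.\<close>

lemma harm_fps_sums:
  assumes "\<bar>t\<bar> < (1::real)"
  shows "(\<lambda>M. fps_nth (harm_fps M) n * t ^ M) sums ((- ln (1 - t)) ^ n / fact n / (1 - t))"
  using assms
proof (induction n arbitrary: t)
  case 0
  then show ?case using geometric_sums[of t] by simp
next
  case (Suc n)
  let ?e = "\<lambda>M. fps_nth (harm_fps M) (Suc n)"
  define U where "U = (\<Sum>M. ?e M * t ^ M)"
  have U: "(\<lambda>M. ?e M * t ^ M) sums U"
    unfolding U_def by (rule summable_sums[OF summable_harm_fps_nth[OF Suc.prems]])
  \<comment> \<open>The dropped term at M = 0 vanishes because \<open>harm_fps 0\<close> has no
    coefficient of positive order.\<close>
  have "(\<lambda>M. ?e (Suc M) * t ^ Suc M) sums U"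
    using U by (subst sums_Suc_iff) (simp add: harm_fps_0)
  moreover have "(\<lambda>M. t * (?e M * t ^ M)) sums (t * U)" by (rule sums_mult[OF U])
  ultimately have "(\<lambda>M. ?e (Suc M) * t ^ Suc M - t * (?e M * t ^ M)) sums (U - t * U)"
    by (rule sums_diff)
  moreover have "?e (Suc M) * t ^ Suc M - t * (?e M * t ^ M) =
      fps_nth (harm_fps M) n / real (Suc M) * t ^ Suc M" for M
    by (simp add: harm_fps_nth_Suc_Suc algebra_simps del: of_nat_Suc)
  ultimately have "(\<lambda>M. fps_nth (harm_fps M) n / real (Suc M) * t ^ Suc M) sums (U - t * U)"
    by simp
  moreover have "(\<lambda>M. fps_nth (harm_fps M) n / real (Suc M) * t ^ Suc M)
    sums ((- ln (1 - t)) ^ Suc n / fact (Suc n))"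
    by (rule harm_fps_sums_integral[OF Suc.prems Suc.IH])
  ultimately have "U - t * U = (- ln (1 - t)) ^ Suc n / fact (Suc n)" by (rule sums_unique2)
  then have "U = (- ln (1 - t)) ^ Suc n / fact (Suc n) / (1 - t)"
  proof (subst nonzero_eq_divide_eq)
    show "1 - t \<noteq> 0" using Suc.prems by auto
  qed (simp only: right_diff_distrib mult.right_neutral mult.commute[of U t])
  then show ?case using U by simp
qed

section \<open>Abel means\<close>

text \<open>The sum starts at index 1, matching the growth classes, which ignore the value at
  0.\<close>

definition abel_mean :: "(nat \<Rightarrow> real) \<Rightarrow> real \<Rightarrow> real" where
  "abel_mean f t = (1 - t) * (\<Sum>M. f (Suc M) * t ^ Suc M)"

lemma summable_abel:
  assumes "polylog_bounded f" "\<bar>t\<bar> < 1"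
  shows "summable (\<lambda>M. f (Suc M) * t ^ Suc M)"
proof -
  obtain C p where C: "C \<ge> 0" "\<And>M. \<bar>f (Suc M)\<bar> \<le> C * (\<Sum>m\<le>p. fps_nth (harm_fps M) m)"
    using polylog_bounded_le_harm_fps[OF assms(1)] by blast
  show ?thesis
  proof (rule summable_comparison_test')
    show "summable (\<lambda>M. C * (\<Sum>m\<le>p. fps_nth (harm_fps M) m * \<bar>t\<bar> ^ M))"
      using assms(2) by (intro summable_mult summable_sum summable_harm_fps_nth) auto
    fix M :: nat
    have "\<bar>t\<bar> ^ Suc M \<le> \<bar>t\<bar> ^ M" using assms(2) by (intro power_decreasing) auto
    then have "\<bar>f (Suc M)\<bar> * \<bar>t\<bar> ^ Suc M \<le> (C * (\<Sum>m\<le>p. fps_nth (harm_fps M) m)) * \<bar>t\<bar> ^ M"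
      using C by (intro mult_mono) (auto intro!: sum_nonneg mult_nonneg_nonneg harm_fps_nth_nonneg)
    then show "norm (f (Suc M) * t ^ Suc M) \<le> C * (\<Sum>m\<le>p. fps_nth (harm_fps M) m * \<bar>t\<bar> ^ M)"
      by (simp add: abs_mult power_abs sum_distrib_right mult.assoc del: power_Suc)
  qed
qed

lemma abel_mean_add:
  assumes "polylog_bounded f" "polylog_bounded g" "\<bar>t\<bar> < 1"
  shows "abel_mean (\<lambda>N. f N + g N) t = abel_mean f t + abel_mean g t"
  unfolding abel_mean_def distrib_right
  by (simp only: suminf_add[OF summable_abel[OF assms(1,3)] summable_abel[OF assms(2,3)], symmetric]
      distrib_left)

lemma abel_mean_cmult:
  assumes "polylog_bounded f" "\<bar>t\<bar> < 1"
  shows "abel_mean (\<lambda>N. c * f N) t = c * abel_mean f t"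
  using suminf_mult[OF summable_abel[OF assms], of c]
  by (simp add: abel_mean_def mult.assoc mult.left_commute)

lemma abel_mean_sum:
  assumes "\<And>i. i \<in> I \<Longrightarrow> polylog_bounded (f i)" "\<bar>t\<bar> < 1"
  shows "abel_mean (\<lambda>N. \<Sum>i\<in>I. f i N) t = (\<Sum>i\<in>I. abel_mean (f i) t)"
  using assms(1)
proof (induction I rule: infinite_finite_induct)
  case (insert i I)
  then show ?case
    using assms(2) by (simp add: abel_mean_add polylog_bounded_sum)
qed (simp_all add: abel_mean_def)

text \<open>The correction for n = 0 is the missing term at index 0, where e_(0,0) = 1.\<close>

lemma abel_mean_harm_fps:
  assumes "\<bar>t\<bar> < 1"
  shows "abel_mean (\<lambda>N. fps_nth (harm_fps N) n) t =
    (- ln (1 - t)) ^ n / fact n - (if n = 0 then 1 - t else 0)"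
proof -
  let ?s = "(- ln (1 - t)) ^ n / fact n / (1 - t)"
  have "(\<lambda>M. fps_nth (harm_fps (Suc M)) n * t ^ Suc M) sums (?s - fps_nth (harm_fps 0) n)"
    using harm_fps_sums[OF assms, of n] by (subst sums_Suc_iff) simp
  then have "(\<Sum>M. fps_nth (harm_fps (Suc M)) n * t ^ Suc M) = ?s - (if n = 0 then 1 else 0)"
    by (simp add: sums_iff harm_fps_0)
  moreover have "(1 - t) * (a / (1 - t) - b) = a - (1 - t) * b" for a b
    using assms by (simp add: right_diff_distrib)
  ultimately show ?thesis by (simp add: abel_mean_def)
qed

text \<open>The terms of f are dominated by multiples of e_(M,m) / (M + 1), whose series is a pure
  power of - log (1 - t). Thus the prefactor 1 - t of the mean survives.\<close>

lemma abel_mean_polylog_small: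
  assumes "polylog_small f"
  obtains C p where "\<And>t. 0 \<le> t \<Longrightarrow> t < 1 \<Longrightarrow>
    \<bar>abel_mean f t\<bar> \<le> (1 - t) * (C * (\<Sum>m\<le>p. (- ln (1 - t)) ^ Suc m / fact (Suc m)))"
proof -
  obtain C p where C: "C \<ge> 0"
      "\<And>M. \<bar>real (Suc M) * f (Suc M)\<bar> \<le> C * (\<Sum>m\<le>p. fps_nth (harm_fps M) m)"
    using polylog_bounded_le_harm_fps[OF assms[unfolded polylog_small_def]] by blast
  show ?thesis
  proof (rule that[of C p])
    fix t :: real assume t: "0 \<le> t" "t < 1"
    define g where "g = (\<lambda>M. C * (\<Sum>m\<le>p. fps_nth (harm_fps M) m / real (Suc M) * t ^ Suc M))"
    have g: "g sums (C * (\<Sum>m\<le>p. (- ln (1 - t)) ^ Suc m / fact (Suc m)))"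
      unfolding g_def using t
      by (intro sums_mult sums_sum harm_fps_sums_integral harm_fps_sums) auto
    have le: "norm (f (Suc M) * t ^ Suc M) \<le> g M" for M
    proof -
      have "\<bar>f (Suc M)\<bar> \<le> C * (\<Sum>m\<le>p. fps_nth (harm_fps M) m) / real (Suc M)"
        using C(2)[of M] by (simp add: abs_mult pos_le_divide_eq mult.commute del: of_nat_Suc)
      then have "\<bar>f (Suc M)\<bar> * t ^ Suc M \<le>
          C * (\<Sum>m\<le>p. fps_nth (harm_fps M) m) / real (Suc M) * t ^ Suc M"
        using t by (intro mult_right_mono) auto
      also have "\<dots> = g M"
        by (simp add: g_def sum_distrib_left sum_distrib_right sum_divide_distrib mult.assoc)
      finally show ?thesis using t by (simp add: abs_mult del: power_Suc)
    qed
    have "\<bar>\<Sum>M. f (Suc M) * t ^ Suc M\<bar> \<le> suminf g"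
      using norm_suminf_le[OF le sums_summable[OF g]] by (simp only: real_norm_def)
    then show "\<bar>abel_mean f t\<bar> \<le> (1 - t) * (C * (\<Sum>m\<le>p. (- ln (1 - t)) ^ Suc m / fact (Suc m)))"
      using t g by (simp add: abel_mean_def abs_mult sums_iff mult_left_mono)
  qed
qed

section \<open>Comparison of the two regularisations\<close>

text \<open>Grouping by the largest entry n, the coefficient of t^(n+x) is zeta_(n+1) - zeta_n.
  Summation by parts and t^(n+x) = t^(x-1) t^(n+1) give the formula.\<close>

lemma Li_eq_abel_mean:
  assumes x: "\<bar>x\<bar> < 1" and t: "0 < t" "t < 1"
    and bounded: "polylog_bounded (zeta_trunc x (ks @ [k]))"
  shows "Li x (ks @ [k]) t = t powr (x - 1) * abel_mean (zeta_trunc x (ks @ [k])) t"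
proof -
  let ?Z = "zeta_trunc x (ks @ [k])" and ?r = "length ks"
  define S where "S = t powr (x - 1) * abel_mean ?Z t"
  define g where "g = (\<lambda>n. t powr (real n + x) * (zeta_trunc x ks n / (real n + x) ^ k))"
  define f where "f = (\<lambda>(n, ms). t powr (real n + x) * mz_term x (ks @ [k]) (ms @ [n]))"
  have pos: "real n + x > 0" if "n \<in> {0<..}" for n :: nat
  proof -
    have "real n \<ge> 1" using that by simp
    then show ?thesis using x by linarith
  qed
  define U where "U = (\<Sum>M. ?Z (Suc M) * t ^ Suc M)"
  have U: "(\<lambda>M. ?Z (Suc M) * t ^ Suc M) sums U"
    unfolding U_def by (rule summable_sums[OF summable_abel[OF bounded]]) (use t in auto)
  \<comment> \<open>The first term drops out because the truncated sum of a nonempty index is 0 at N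
    = 1.\<close>
  have "(\<lambda>M. ?Z (Suc (Suc M)) * t ^ Suc (Suc M)) sums U"
    using sums_Suc_iff[of "\<lambda>M. ?Z (Suc M) * t ^ Suc M" U] U by simp
  from sums_mult[OF sums_diff[OF this sums_mult[OF U, of t]], of "t powr (x - 1)"]
  have "(\<lambda>M. t powr (x - 1) * (?Z (Suc (Suc M)) * t ^ Suc (Suc M) - t * (?Z (Suc M) * t ^ Suc M)))
      sums (t powr (x - 1) * (U - t * U))" .
  moreover have "t powr (x - 1) * (?Z (Suc (Suc M)) * t ^ Suc (Suc M) - t * (?Z (Suc M) * t ^ Suc M))
      = g (Suc M)" for M
  proof -
    have "t powr (x - 1) * (?Z (Suc (Suc M)) * t ^ Suc (Suc M) - t * (?Z (Suc M) * t ^ Suc M)) =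
        (t powr (x - 1) * t ^ Suc (Suc M)) * (?Z (Suc (Suc M)) - ?Z (Suc M))"
      by (simp add: algebra_simps)
    also have "t powr (x - 1) * t ^ Suc (Suc M) = t powr (x - 1 + real (Suc (Suc M)))"
      using t by (simp only: powr_add powr_realpow)
    also have "x - 1 + real (Suc (Suc M)) = real (Suc M) + x" by simp
    also have "?Z (Suc (Suc M)) - ?Z (Suc M) = zeta_trunc x ks (Suc M) / (real (Suc M) + x) ^ k"
      by (rule zeta_trunc_snoc_Suc) simp
    finally show ?thesis unfolding g_def .
  qed
  ultimately have "(\<lambda>M. g (Suc M)) sums (t powr (x - 1) * (U - t * U))" by simp
  also have "t powr (x - 1) * (U - t * U) = S"
    by (simp add: S_def abel_mean_def U_def left_diff_distrib)
  finally have "(\<lambda>M. g (Suc M)) sums S" .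
  \<comment> \<open>Nonnegative terms make the ordered sum unconditional, as the unordered sum in
    \<open>Li\<close> requires.\<close>
  then have "((\<lambda>M. g (Suc M)) has_sum S) UNIV"
  proof (rule sums_nonneg_imp_has_sum)
    fix M show "g (Suc M) \<ge> 0"
      using pos[of "Suc M"] zeta_trunc_nonneg[OF x, of ks "Suc M"] by (simp add: g_def)
  qed
  moreover have "bij_betw Suc UNIV {0<..}"
    by (rule bij_betwI[where g = "\<lambda>n. n - 1"]) auto
  ultimately have g: "(g has_sum S) {0<..}"
    using has_sum_reindex_bij_betw[of Suc UNIV "{0<..}" g S] by simp
  have f_sum: "((\<lambda>ms. f (n, ms)) has_sum g n) (incr_tuples ?r ({0<..} \<inter> {..<n}))" if "n \<in> {0<..}" for n
  proof (rule has_sum_finiteI)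
    show "finite (incr_tuples ?r ({0<..} \<inter> {..<n}))" by (intro finite_incr_tuples) auto
    have "{0<..} \<inter> {..<n} = {0<..<n}" by auto
    then show "g n = (\<Sum>ms\<in>incr_tuples ?r ({0<..} \<inter> {..<n}). f (n, ms))"
      unfolding g_def f_def zeta_trunc_def sum_divide_distrib sum_distrib_left
      by (intro sum.cong) (auto simp: incr_tuples_def mz_term_snoc)
  qed
  have f_nonneg: "f (n, ms) \<ge> 0" if "n \<in> {0<..}" "ms \<in> incr_tuples ?r ({0<..} \<inter> {..<n})" for n ms
  proof -
    have "length ms = ?r" "ms \<in> incr_tuples ?r {0<..}" using that by (auto simp: incr_tuples_def)
    then show ?thesis
      using pos[OF that(1)] mz_term_nonneg[OF x] by (simp add: f_def mz_term_snoc)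
  qed
  have "f summable_on (SIGMA n:{0<..}. incr_tuples ?r ({0<..} \<inter> {..<n}))"
    by (rule summable_on_SigmaI[OF f_sum _ f_nonneg])
      (use g in \<open>auto simp: summable_on_def\<close>)
  then have "(f has_sum S) (SIGMA n:{0<..}. incr_tuples ?r ({0<..} \<inter> {..<n}))"
    by (intro has_sum_SigmaI[OF f_sum g])
  then have "((\<lambda>ms. t powr (real (last ms) + x) * mz_term x (ks @ [k]) ms) has_sum S)
      (incr_tuples (Suc ?r) {0<..})"
    using has_sum_reindex_bij_betw[OF bij_betw_incr_tuples_snoc[of "{0<..}" ?r],
        of "\<lambda>ms. t powr (real (last ms) + x) * mz_term x (ks @ [k]) ms" S]
    by (simp add: f_def case_prod_unfold)
  then show ?thesis
    by (simp add: Li_def S_def infsumI)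
qed

text \<open>The source of uniqueness for both regularised polynomials: a nonconstant polynomial is
  unbounded along g, and a constant one is its own limit.\<close>

lemma poly_eq_0_if_tendsto_0:
  fixes Q :: "real poly"
  assumes "filterlim g at_top F" "F \<noteq> bot" "((\<lambda>u. poly Q (g u)) \<longlongrightarrow> 0) F"
  shows "Q = 0"
proof (rule ccontr)
  assume "Q \<noteq> 0"
  show False
  proof (cases "degree Q = 0")
    case True
    then obtain c where "Q = [:c:]" using degree_eq_zeroE by blast
    then show False
      using assms(3) \<open>Q \<noteq> 0\<close> tendsto_unique[OF assms(2) tendsto_const, of c 0] by simp
  next
    case False
    then have "filterlim (poly Q) at_infinity at_infinity"
      by (intro filterlim_poly_at_infinity) auto
    moreover have "filterlim g at_infinity F"
      using assms(1) at_top_le_at_infinity filterlim_mono by blast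
    ultimately have "filterlim (\<lambda>u. poly Q (g u)) at_infinity F"
      by (rule filterlim_compose)
    then show False
      using not_tendsto_and_filterlim_at_infinity[OF assms(2,3)] by blast
  qed
qed

section \<open>Error terms as t tends to 1 from the left\<close>

definition left_error :: "(real \<Rightarrow> real) \<Rightarrow> bool" where
  "left_error f \<longleftrightarrow> (\<exists>p>0. f \<in> O[at_left 1](\<lambda>t. (1 - t) * ln (1 - t) ^ p))"

lemma bigo_ln_power_mono:
  assumes "p \<le> q"
  shows "(\<lambda>t::real. ln (1 - t) ^ p) \<in> O[at_left 1](\<lambda>t. ln (1 - t) ^ q)"
proof (rule bigoI[of _ 1])
  have "\<forall>\<^sub>F t::real in at_left 1. \<bar>ln (1 - t)\<bar> \<ge> 1" by real_asymp
  then show "\<forall>\<^sub>F t::real in at_left 1. norm (ln (1 - t) ^ p) \<le> 1 * norm (ln (1 - t) ^ q)"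
    by eventually_elim (use assms in \<open>simp add: power_abs power_increasing\<close>)
qed

lemma left_error_mono:
  fixes f :: "real \<Rightarrow> real"
  assumes "f \<in> O[at_left 1](\<lambda>t. (1 - t) * ln (1 - t) ^ p)"
  shows "f \<in> O[at_left 1](\<lambda>t. (1 - t) * ln (1 - t) ^ (p + q))"
  by (rule landau_o.big_trans[OF assms]) (intro landau_o.big.mult_left bigo_ln_power_mono, simp)

text \<open>Here p may be 0; raising the exponent by one gives the positive exponent that
  \<open>left_error\<close> demands.\<close>

lemma left_errorI:
  "f \<in> O[at_left 1](\<lambda>t. (1 - t) * ln (1 - t) ^ p) \<Longrightarrow> left_error f"
  unfolding left_error_def using left_error_mono[of f p 1] by (intro exI[of _ "p + 1"]) simp

lemma left_error_add:
  assumes "left_error f" "left_error g"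
  shows "left_error (\<lambda>t. f t + g t)"
proof -
  obtain p q where "f \<in> O[at_left 1](\<lambda>t. (1 - t) * ln (1 - t) ^ p)"
    "g \<in> O[at_left 1](\<lambda>t. (1 - t) * ln (1 - t) ^ q)"
    using assms by (auto simp: left_error_def)
  from sum_in_bigo(1)[OF left_error_mono[OF this(1), of q] left_error_mono[OF this(2), of p, folded add.commute[of p q]]]
  show ?thesis by (rule left_errorI)
qed

lemma left_error_diff:
  assumes "left_error f" "left_error g"
  shows "left_error (\<lambda>t. f t - g t)"
proof -
  have "left_error (\<lambda>t. - g t)" using assms(2) by (simp add: left_error_def)
  from left_error_add[OF assms(1) this] show ?thesis by simp
qed

lemma left_error_cong:
  assumes "left_error f" "\<forall>\<^sub>F t in at_left 1. f t = g t"
  shows "left_error g"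
  using assms landau_o.big.in_cong[OF assms(2)] by (auto simp: left_error_def)

lemma poly_neg_ln_bigo:
  fixes Q :: "real poly"
  shows "(\<lambda>t. poly Q (- ln (1 - t))) \<in> O[at_left 1](\<lambda>t. ln (1 - t) ^ degree Q)"
proof -
  have "(\<lambda>t. coeff Q i * (- ln (1 - t)) ^ i) \<in> O[at_left 1](\<lambda>t. ln (1 - t) ^ degree Q)"
    if "i \<le> degree Q" for i
  proof -
    have "(\<lambda>t. coeff Q i * (- ln (1 - t)) ^ i) = (\<lambda>t. (coeff Q i * (-1) ^ i) * ln (1 - t) ^ i)"
      by (rule ext) (simp add: power_minus[of "ln _"])
    then show ?thesis using bigo_ln_power_mono[OF that] by simp
  qed
  then show ?thesis unfolding poly_altdef by (intro big_sum_in_bigo) auto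
qed

lemma left_error_tendsto_0:
  assumes "left_error f" shows "(f \<longlongrightarrow> 0) (at_left 1)"
proof -
  obtain p where p: "f \<in> O[at_left 1](\<lambda>t. (1 - t) * ln (1 - t) ^ p)"
    using assms by (auto simp: left_error_def)
  \<comment> \<open>The limit is taken at infinity and pulled back along u = 1 / (1 - t); the sign
    of the logarithm is restored afterwards.\<close>
  have "((\<lambda>u::real. ln u ^ p / u) \<longlongrightarrow> 0) at_top" by real_asymp
  moreover have "filterlim (\<lambda>t::real. 1 / (1 - t)) at_top (at_left 1)" by real_asymp
  ultimately have "((\<lambda>t::real. ln (1 / (1 - t)) ^ p / (1 / (1 - t))) \<longlongrightarrow> 0) (at_left 1)"
    by (rule filterlim_compose)
  moreover have "\<forall>\<^sub>F t::real in at_left 1.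
      ln (1 / (1 - t)) ^ p / (1 / (1 - t)) = (1 - t) * (- ln (1 - t)) ^ p"
    using eventually_at_left_real[OF zero_less_one]
    by eventually_elim (simp add: ln_div)
  ultimately have "((\<lambda>t::real. (1 - t) * (- ln (1 - t)) ^ p) \<longlongrightarrow> 0) (at_left 1)"
    by (rule Lim_transform_eventually)
  then have "((\<lambda>t::real. (-1) ^ p * ((1 - t) * (- ln (1 - t)) ^ p)) \<longlongrightarrow> 0) (at_left 1)"
    by (rule tendsto_mult_right_zero)
  moreover have "(-1) ^ p * ((1 - t) * (- ln (1 - t)) ^ p) = (1 - t) * ln (1 - t) ^ p" for t :: real
    using power_mult_distrib[of "-1" "- ln (1 - t)" p] by simp
  ultimately have "((\<lambda>t::real. (1 - t) * ln (1 - t) ^ p) \<longlongrightarrow> 0) (at_left 1)" by simp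
  then have "(\<lambda>t::real. (1 - t) * ln (1 - t) ^ p) \<in> o[at_left 1](\<lambda>_. 1)"
    by (intro smalloI_tendsto) auto
  from landau_o.big_small_trans[OF p this] show ?thesis by (auto dest: smalloD_tendsto)
qed

text \<open>Two admissible polynomials differ by one that tends to 0 along - log (1 - t), which
  tends to infinity, so they coincide.\<close>

lemma Ppoly_eqI:
  assumes "left_error (\<lambda>t. Li x ks t - poly Q (- ln (1 - t)))"
  shows "Ppoly x ks = Q"
  unfolding Ppoly_def left_error_def[symmetric]
proof (rule the_equality)
  show "left_error (\<lambda>t. Li x ks t - poly Q (- ln (1 - t)))" by (rule assms)
  fix R assume "left_error (\<lambda>t. Li x ks t - poly R (- ln (1 - t)))"
  from left_error_tendsto_0[OF left_error_diff[OF assms this]]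
  have "((\<lambda>t. poly (R - Q) (- ln (1 - t))) \<longlongrightarrow> 0) (at_left 1)" by simp
  moreover have "filterlim (\<lambda>t::real. - ln (1 - t)) at_top (at_left 1)" by real_asymp
  ultimately have "R - Q = 0" by (intro poly_eq_0_if_tendsto_0[where F = "at_left 1"]) auto
  then show "R = Q" by simp
qed

lemma polylog_small_imp_bigo:
  assumes "polylog_small f"
  shows "\<exists>p>0. f \<in> O(\<lambda>N. ln (real N) ^ p / real N)"
proof -
  obtain C p where C: "C \<ge> 0" "\<And>N. N \<ge> 1 \<Longrightarrow> \<bar>real N * f N\<bar> \<le> C * (1 + ln (real N)) ^ p"
    using polylog_boundedE[OF assms[unfolded polylog_small_def]] by blast
  \<comment> \<open>Eventually 1 + log N <= 2 log N, which costs 2^p; \<open>Suc p\<close> keeps the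
    exponent positive.\<close>
  have "f \<in> O(\<lambda>N. ln (real N) ^ Suc p / real N)"
  proof (rule bigoI[of _ "C * 2 ^ p"])
    have "\<forall>\<^sub>F N in sequentially. ln (real N) \<ge> 1" by real_asymp
    then show "\<forall>\<^sub>F N in sequentially. norm (f N) \<le> C * 2 ^ p * norm (ln (real N) ^ Suc p / real N)"
      using eventually_ge_at_top[of 1]
    proof eventually_elim
      case (elim N)
      have "(1 + ln (real N)) ^ p \<le> (2 * ln (real N)) ^ p" using elim by (intro power_mono) auto
      also have "\<dots> = 2 ^ p * ln (real N) ^ p" by (simp only: power_mult_distrib)
      also have "\<dots> \<le> 2 ^ p * ln (real N) ^ Suc p"
        using elim by (intro mult_left_mono power_increasing) auto
      finally have "C * (1 + ln (real N)) ^ p \<le> C * (2 ^ p * ln (real N) ^ Suc p)"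
        using C(1) by (rule mult_left_mono)
      with C(2)[OF elim(2)] have "real N * \<bar>f N\<bar> \<le> C * (2 ^ p * ln (real N) ^ Suc p)"
        by (simp only: abs_mult abs_of_nat)
      then show ?case using elim by (simp add: pos_le_divide_eq mult_ac del: power_Suc)
    qed
  qed
  then show ?thesis by blast
qed

lemma Zstar_eqI:
  assumes "polylog_small (\<lambda>N. zeta_trunc x ks N - poly Q (ln (real N) - Digamma (1 + x)))"
  shows "Zstar x ks = Q"
  unfolding Zstar_def
proof (rule the_equality)
  show Q: "\<exists>p>0. (\<lambda>N. zeta_trunc x ks N - poly Q (ln (real N) - Digamma (1 + x)))
      \<in> O(\<lambda>N. ln (real N) ^ p / real N)"
    by (rule polylog_small_imp_bigo[OF assms])
  have lim: "(f \<longlongrightarrow> 0) sequentially" if "f \<in> O(\<lambda>N. ln (real N) ^ p / real N)" for f :: "nat \<Rightarrow> real" and p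
  proof -
    have "((\<lambda>N. ln (real N) ^ p / real N) \<longlongrightarrow> 0) sequentially" by real_asymp
    then have "(\<lambda>N. ln (real N) ^ p / real N) \<in> o(\<lambda>_. 1)" by (intro smalloI_tendsto) auto
    from landau_o.big_small_trans[OF that this] show ?thesis by (auto dest: smalloD_tendsto)
  qed
  fix R assume "\<exists>p>0. (\<lambda>N. zeta_trunc x ks N - poly R (ln (real N) - Digamma (1 + x)))
      \<in> O(\<lambda>N. ln (real N) ^ p / real N)"
  with Q lim have
    "(\<lambda>N. zeta_trunc x ks N - poly Q (ln (real N) - Digamma (1 + x))) \<longlonglongrightarrow> 0"
    "(\<lambda>N. zeta_trunc x ks N - poly R (ln (real N) - Digamma (1 + x))) \<longlonglongrightarrow> 0"
    by blast+
  from tendsto_diff[OF this]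
  have "(\<lambda>N. poly (R - Q) (ln (real N) - Digamma (1 + x))) \<longlonglongrightarrow> 0" by simp
  moreover have "filterlim (\<lambda>N. ln (real N) - Digamma (1 + x)) at_top sequentially" by real_asymp
  ultimately have "R - Q = 0" by (intro poly_eq_0_if_tendsto_0[where F = sequentially]) auto
  then show "R = Q" by simp
qed

section \<open>Transfer from truncated sums to polylogarithms\<close>

lemma poly_rho:
  "poly (rho W) T =
    (\<Sum>n\<le>degree W. coeff W n * fact n * (\<Sum>j\<le>n. fps_nth A_fps j * (T ^ (n - j) / fact (n - j))))"
  by (simp add: rho_def A_exp_Ty_def exp_Ty_def fps_mult_nth poly_sum poly_monom atLeast0AtMost)

text \<open>Powers of log N + gamma are replaced by combinations of the e_(N,n), whose Abel means
  are exact; the coefficients of A used in this replacement are those that define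
  \<open>rho\<close>.\<close>

lemma left_error_abel_mean_rho:
  assumes "polylog_small (\<lambda>N. f N - poly W (ln (real N) + euler_mascheroni))"
  shows "left_error (\<lambda>t. abel_mean f t - poly (rho W) (- ln (1 - t)))"
proof -
  define l where "l = (\<lambda>N. ln (real N) + euler_mascheroni)"
  define e where "e = (\<lambda>n N. fps_nth (harm_fps N) n)"
  \<comment> \<open>The model for f: each (log N + gamma)^n in W becomes n! times the coefficient of
    y^n in A(y) times the harmonic product.\<close>
  define m where "m = (\<lambda>N. \<Sum>n\<le>degree W. (coeff W n * fact n) * (\<Sum>j\<le>n. fps_nth A_fps j * e (n - j) N))"
  define s where "s = (\<lambda>N. f N - m N)"
  have e: "polylog_bounded (e n)" for n
    unfolding e_def by (rule polylog_bounded_harm_fps_nth)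
  have m: "polylog_bounded m"
    unfolding m_def by (intro polylog_bounded_sum polylog_bounded_cmult e)
  have s: "polylog_small s"
  proof (rule polylog_small_cong)
    show "polylog_small (\<lambda>N. (f N - poly W (l N))
        - (\<Sum>n\<le>degree W. (coeff W n * fact n) * (fps_nth (A_fps * harm_fps N) n - l N ^ n / fact n)))"
      unfolding l_def
      by (rule polylog_small_diff[OF assms polylog_small_sum[OF
              polylog_small_cmult[OF polylog_small_A_harm_nth]]])
    fix N
    show "s N = (f N - poly W (l N))
        - (\<Sum>n\<le>degree W. (coeff W n * fact n) * (fps_nth (A_fps * harm_fps N) n - l N ^ n / fact n))"
      by (simp add: s_def m_def e_def poly_altdef fps_mult_nth atLeast0AtMost
          right_diff_distrib sum_subtractf)
  qed
  obtain C p where C: "\<And>t. 0 \<le> t \<Longrightarrow> t < 1 \<Longrightarrow>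
      \<bar>abel_mean s t\<bar> \<le> (1 - t) * (C * (\<Sum>m\<le>p. (- ln (1 - t)) ^ Suc m / fact (Suc m)))"
    using abel_mean_polylog_small[OF s] by blast
  define R where "R = smult C (\<Sum>m\<le>p. monom (1 / fact (Suc m)) (Suc m))"
  have ev: "\<forall>\<^sub>F t in at_left (1::real). 0 < t \<and> t < 1"
    using eventually_at_left_real[OF zero_less_one] by eventually_elim simp
  have err_s: "left_error (abel_mean s)"
  proof (rule left_errorI)
    have "abel_mean s \<in> O[at_left 1](\<lambda>t. (1 - t) * poly R (- ln (1 - t)))"
    proof (rule bigoI[of _ 1])
      show "\<forall>\<^sub>F t in at_left 1. norm (abel_mean s t) \<le> 1 * norm ((1 - t) * poly R (- ln (1 - t)))"
        using ev
      proof eventually_elim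
        case (elim t)
        have "C * (\<Sum>m\<le>p. (- ln (1 - t)) ^ Suc m / fact (Suc m)) = poly R (- ln (1 - t))"
          by (simp add: R_def poly_sum poly_monom del: power_Suc fact_Suc)
        then show ?case using C[of t] elim by simp
      qed
    qed
    also have "(\<lambda>t. (1 - t) * poly R (- ln (1 - t))) \<in> O[at_left 1](\<lambda>t. (1 - t) * ln (1 - t) ^ degree R)"
      by (intro landau_o.big.mult_left poly_neg_ln_bigo)
    finally show "abel_mean s \<in> O[at_left 1](\<lambda>t. (1 - t) * ln (1 - t) ^ degree R)" .
  qed
  \<comment> \<open>Collects the index-0 corrections, one for each n from j = n; together they
    amount to K (1 - t), which is an admissible error.\<close>
  define K where "K = (\<Sum>n\<le>degree W. (coeff W n * fact n) * fps_nth A_fps n)"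
  have "left_error (\<lambda>t. - K * (1 - t))"
    by (rule left_errorI[of _ 0]) simp
  from left_error_add[OF err_s this] show ?thesis
  proof (rule left_error_cong, use ev in eventually_elim)
    case (elim t)
    define T where "T = - ln (1 - t)"
    have t: "\<bar>t\<bar> < 1" using elim by auto
    have "abel_mean m t = (\<Sum>n\<le>degree W. (coeff W n * fact n) *
        (\<Sum>j\<le>n. fps_nth A_fps j * abel_mean (e (n - j)) t))"
      unfolding m_def using t e
      by (simp add: abel_mean_sum abel_mean_cmult polylog_bounded_sum polylog_bounded_cmult)
    also have "\<dots> = (\<Sum>n\<le>degree W. (coeff W n * fact n) *
        ((\<Sum>j\<le>n. fps_nth A_fps j * (T ^ (n - j) / fact (n - j))) - fps_nth A_fps n * (1 - t)))"
    proof (intro sum.cong refl arg_cong2[of _ _ _ _ "(*)"])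
      fix n
      have "(\<Sum>j\<le>n. fps_nth A_fps j * abel_mean (e (n - j)) t) =
          (\<Sum>j\<le>n. fps_nth A_fps j * (T ^ (n - j) / fact (n - j))
            - (if j = n then fps_nth A_fps n * (1 - t) else 0))"
        unfolding e_def abel_mean_harm_fps[OF t] T_def
        by (intro sum.cong) (auto simp: right_diff_distrib)
      then show "(\<Sum>j\<le>n. fps_nth A_fps j * abel_mean (e (n - j)) t) =
          (\<Sum>j\<le>n. fps_nth A_fps j * (T ^ (n - j) / fact (n - j))) - fps_nth A_fps n * (1 - t)"
        by (simp add: sum_subtractf)
    qed
    also have "\<dots> = poly (rho W) T - K * (1 - t)"
      by (simp add: poly_rho K_def right_diff_distrib sum_subtractf sum_distrib_right mult.assoc)
    finally have "abel_mean m t = poly (rho W) T - K * (1 - t)" .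
    moreover have "abel_mean f t = abel_mean m t + abel_mean s t"
      using abel_mean_add[OF m polylog_small_imp_bounded[OF s] t] by (simp add: s_def)
    ultimately show ?case by (simp add: T_def)
  qed
qed

lemma left_error_Li:
  assumes x: "\<bar>x\<bar> < 1"
    and W: "polylog_small (\<lambda>N. zeta_trunc x ks N - poly W (ln (real N) + euler_mascheroni))"
  shows "left_error (\<lambda>t. Li x ks t - poly (rho W) (- ln (1 - t)))"
proof -
  define a where "a = abel_mean (zeta_trunc x ks)"
  have ev: "\<forall>\<^sub>F t in at_left (1::real). 0 < t \<and> t < 1"
    using eventually_at_left_real[OF zero_less_one] by eventually_elim simp
  have err: "left_error (\<lambda>t. a t - poly (rho W) (- ln (1 - t)))"
    unfolding a_def by (rule left_error_abel_mean_rho[OF W])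
  have "left_error (\<lambda>t. Li x ks t - a t)"
  proof (cases ks rule: rev_cases)
    case Nil
    \<comment> \<open>For the empty index \<open>Li\<close> is 1 while the Abel mean of the constant
      1 is t.\<close>
    have "left_error (\<lambda>t. 1 - t)" by (rule left_errorI[of _ 0]) simp
    then show ?thesis
    proof (rule left_error_cong, use ev in eventually_elim)
      case (elim t)
      then show ?case
        using abel_mean_harm_fps[of t 0] by (simp add: Nil a_def Li_def abel_mean_def)
    qed
  next
    case (snoc ks' k)
    have bounded: "polylog_bounded (zeta_trunc x ks)"
      using polylog_bounded_add[OF polylog_small_imp_bounded[OF W]
          polylog_bounded_poly[OF polylog_bounded_add[OF polylog_bounded_ln
              polylog_bounded_const[of euler_mascheroni]], of W]]
      by simp
    \<comment> \<open>The factor t^(x-1) differs from 1 by O(1 - t), and \<open>a\<close> grows only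
      like a power of log (1 - t), so removing this factor costs an admissible error.\<close>
    have 1: "(\<lambda>t. t powr (x - 1) - 1) \<in> O[at_left 1](\<lambda>t. 1 - t)" by real_asymp
    obtain p where "(\<lambda>t. a t - poly (rho W) (- ln (1 - t))) \<in> O[at_left 1](\<lambda>t. (1 - t) * ln (1 - t) ^ p)"
      using err by (auto simp: left_error_def)
    also have "(\<lambda>t::real. (1 - t) * ln (1 - t) ^ p) \<in> O[at_left 1](\<lambda>t. 1 * ln (1 - t) ^ p)"
    proof (rule landau_o.big.mult_right)
      show "(\<lambda>t::real. 1 - t) \<in> O[at_left 1](\<lambda>_. 1)"
        by (rule bigoI[of _ 1]) (use ev in eventually_elim, simp)
    qed
    finally have a1: "(\<lambda>t. a t - poly (rho W) (- ln (1 - t))) \<in> O[at_left 1](\<lambda>t. ln (1 - t) ^ p)"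
      by simp
    define d where "d = p + degree (rho W)"
    have "(\<lambda>t. (a t - poly (rho W) (- ln (1 - t))) + poly (rho W) (- ln (1 - t)))
        \<in> O[at_left 1](\<lambda>t. ln (1 - t) ^ d)"
      by (rule sum_in_bigo(1)[OF landau_o.big_trans[OF a1 bigo_ln_power_mono]
            landau_o.big_trans[OF poly_neg_ln_bigo bigo_ln_power_mono]]) (auto simp: d_def)
    then have "a \<in> O[at_left 1](\<lambda>t. ln (1 - t) ^ d)" by simp
    from landau_o.big.mult[OF 1 this]
    have "left_error (\<lambda>t. (t powr (x - 1) - 1) * a t)" by (rule left_errorI)
    then show ?thesis
    proof (rule left_error_cong, use ev in eventually_elim)
      case (elim t)
      then show ?case
        using Li_eq_abel_mean[OF x _ _ bounded[unfolded snoc], of t]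
        by (simp add: snoc a_def algebra_simps)
    qed
  qed
  from left_error_add[OF this err] show ?thesis by simp
qed

theorem theorem2p2:
  fixes x :: real and ks :: "nat list"
  assumes "\<bar>x\<bar> < 1" and "\<forall>k\<in>set ks. k > 0"
  shows "Ppoly x ks = rho (pcompose (Zstar x ks) [:- euler_mascheroni - Digamma (1 + x), 1:])"
proof -
  obtain Q where Q: "polylog_small (\<lambda>N. zeta_trunc x ks N - poly Q (ln (real N)))"
    using zeta_trunc_expansion[OF assms] by blast
  \<comment> \<open>\<open>Zstar\<close> is evaluated at log N - psi(1 + x), so the shift by psi(1 +
    x) recovers Q(log N).\<close>
  have "Zstar x ks = pcompose Q [:Digamma (1 + x), 1:]"
    by (rule Zstar_eqI) (use Q in \<open>simp add: poly_pcompose\<close>)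
  \<comment> \<open>At T = log N + gamma the argument T - gamma - psi(1 + x) is log N - psi(1 + x),
    so the composed polynomial again takes the value Q(log N).\<close>
  then have "polylog_small (\<lambda>N. zeta_trunc x ks N -
      poly (pcompose (Zstar x ks) [:- euler_mascheroni - Digamma (1 + x), 1:])
        (ln (real N) + euler_mascheroni))"
    using Q by (simp add: poly_pcompose)
  from left_error_Li[OF assms(1) this] show ?thesis by (rule Ppoly_eqI)
qed

end
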